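(* Let $\mathbb{K}$ be an algebraically closed commutative field, $N\geq 1$, $a=(1,0,\ldots,0)\in\mathbb{K}^N$, and let $V$ be a finite-dimensional module over the Lie algebra $\mathfrak{g}_a$, with $\epsilon_i$ acting by $F_i\in\mathrm{End}(V)$. The decomposition of $V$ into indecomposable $\mathfrak{g}_a$-modules induces a graduation of the post-Lie algebra $\mathfrak{g}'_a=(T(V)^N,{}_a[-,-],* )$: for the grading $\left((\mathfrak{g}'_a)_n\right)_{n\geq 0}$ of $T(V)^N$ defined in the context, one has $\mathfrak{g}'_a=\bigoplus_{n\ge0}(\mathfrak{g}'_a)_n$ and, for all $m,n\geq 0$, $${}_a[(\mathfrak{g}'_a)_m,(\mathfrak{g}'_a)_n]\subseteq(\mathfrak{g}'_a)_{m+n},\qquad (\mathfrak{g}'_a)_m*(\mathfrak{g}'_a)_n\subseteq(\mathfrak{g}'_a)_{m+n}.$$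
   Context: $(\epsilon_1,\ldots,\epsilon_N)$ is the canonical basis of $\mathbb{K}^N$; $\mathfrak{g}_a=\mathbb{K}^N$ with Lie bracket $[\epsilon_i,\epsilon_j]_a=a_j\epsilon_i-a_i\epsilon_j$. $T(V)$ has empty word $\emptyset$ and shuffle product $sh$. On $T(V)^N$ (elements written $f_1\epsilon_1+\ldots+f_N\epsilon_N$), for $f,g\in T(V)$, $x\in V$: ${}_a[f\epsilon_i,g\epsilon_j]=(f\,sh\,g)(a_i\epsilon_j-a_j\epsilon_i)$, and $*$ is defined inductively by $\emptyset\epsilon_i*g\epsilon_j=0$, $(xf)\epsilon_i*g\epsilon_j=x(f\epsilon_i*g\epsilon_j)+F_j(x)(f\,sh\,g)\epsilon_i$. Since $V$ is a $\mathfrak{g}_a$-module, $(T(V)^N,{}_a[-,-],* )$ is a post-Lie algebra (${}_a[-,-]$ is a Lie bracket, $u*{}_a[v,w]=(u*v)*w-u*(v*w)-(u*w)*v+u*(w*v)$ and ${}_a[u,v]*w={}_a[u*w,v]+{}_a[u,v*w]$). The grading: write $V$ as a direct sum of indecomposable $\mathfrak{g}_a$-modules. Decompose each indecomposable summand $U$ as $U=U^{(0)}\oplus\ldots\oplus U^{(k_U)}$, where there is a scalar $\lambda_U$ such that, for all $p$, $U^{(p)}$ is stable under $\epsilon_1$ with $\epsilon_1-(\lambda_U+p)\mathrm{Id}$ nilpotent on $U^{(p)}$, and $\epsilon_i(U^{(p)})\subseteq U^{(p-1)}$ for $i\geq 2$ (with $U^{(-1)}=(0)$). Summing over the summands ($V^{(p)}=\bigoplus_U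 U^{(p)}$, with $U^{(p)}=(0)$ for $p>k_U$), one gets $V=V^{(0)}\oplus\ldots\oplus V^{(k)}$ with $F_1(V^{(p)})\subseteq V^{(p)}$ and $F_i(V^{(p)})\subseteq V^{(p-1)}$ for $i\geq 2$. Put $V_p=V^{(k+1-p)}$ for $p\in\{1,\ldots,k+1\}$. This grading of $V$ induces a connected grading $(T(V)_n)_{n\geq 0}$ of $T(V)$ (the degree of a word is the sum of the degrees of its letters), and $$(\mathfrak{g}'_a)_n=T(V)_n\epsilon_1\oplus\bigoplus_{i=2}^N T(V)_{n-1}\epsilon_i,\qquad T(V)_{-1}=(0).$$ *)

theory Defs
  imports
    "HOL-Computational_Algebra.Polynomial"
    "HOL-Library.Poly_Mapping"
begin

section \<open>Finitely supported families as vector spaces\<close>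

definition pm_scale :: "'k::field \<Rightarrow> ('i \<Rightarrow>\<^sub>0 'k) \<Rightarrow> ('i \<Rightarrow>\<^sub>0 'k)"
  where "pm_scale c f = Poly_Mapping.map ((*) c) f"

definition pm_scale2 :: "'k::field \<Rightarrow> ('j \<Rightarrow>\<^sub>0 ('i \<Rightarrow>\<^sub>0 'k)) \<Rightarrow> ('j \<Rightarrow>\<^sub>0 ('i \<Rightarrow>\<^sub>0 'k))"
  where "pm_scale2 c u = Poly_Mapping.map (pm_scale c) u"

text \<open>Linear extension of a family indexed by basis vectors.\<close>

definition lin_ext :: "('i \<Rightarrow> ('j \<Rightarrow>\<^sub>0 'k)) \<Rightarrow> ('i \<Rightarrow>\<^sub>0 'k::field) \<Rightarrow> ('j \<Rightarrow>\<^sub>0 'k)"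
  where "lin_ext h f = (\<Sum>w\<in>Poly_Mapping.keys f. pm_scale (Poly_Mapping.lookup f w) (h w))"

lemma lookup_pm_scale [simp]:
  "Poly_Mapping.lookup (pm_scale c f) i = c * Poly_Mapping.lookup f i"
  by (simp add: pm_scale_def map.rep_eq when_def)

lemma pm_scale_simps [simp]:
  "pm_scale c 0 = 0" "pm_scale 0 f = 0" "pm_scale 1 f = f"
  "pm_scale c (pm_scale d f) = pm_scale (c * d) f"
  "pm_scale c (Poly_Mapping.single i x) = Poly_Mapping.single i (c * x)"
  by (auto intro!: poly_mapping_eqI simp: lookup_single when_def)

lemma pm_scale_add: "pm_scale c (f + g) = pm_scale c f + pm_scale c g"
  by (rule poly_mapping_eqI) (simp add: lookup_add algebra_simps)

lemma pm_scale_add_left: "pm_scale (c + d) f = pm_scale c f + pm_scale d f"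
  by (rule poly_mapping_eqI) (simp add: lookup_add algebra_simps)

lemma pm_scale_sum: "pm_scale c (sum h A) = (\<Sum>x\<in>A. pm_scale c (h x))"
  by (rule poly_mapping_eqI) (simp add: lookup_sum sum_distrib_left)

lemma vector_space_pm_scale: "vector_space pm_scale"
  by unfold_locales (simp_all add: pm_scale_add pm_scale_add_left)

lemma lookup_pm_scale2 [simp]:
  "Poly_Mapping.lookup (pm_scale2 c u) i = pm_scale c (Poly_Mapping.lookup u i)"
  by (simp add: pm_scale2_def map.rep_eq when_def)

lemma vector_space_pm_scale2: "vector_space pm_scale2"
  by unfold_locales
    (auto intro!: poly_mapping_eqI simp: lookup_add algebra_simps)

lemma lin_ext_superset:
  assumes "finite A" "Poly_Mapping.keys f \<subseteq> A"
  shows "lin_ext h f = (\<Sum>w\<in>A. pm_scale (Poly_Mapping.lookup f w) (h w))"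
  unfolding lin_ext_def
  by (rule sum.mono_neutral_left) (use assms in \<open>auto simp: in_keys_iff\<close>)

lemma lin_ext_0 [simp]: "lin_ext h 0 = 0"
  by (simp add: lin_ext_def)

lemma lin_ext_single [simp]: "lin_ext h (Poly_Mapping.single w c) = pm_scale c (h w)"
  by (subst lin_ext_superset[of "{w}"]) auto

lemma lin_ext_add: "lin_ext h (f + g) = lin_ext h f + lin_ext h g"
proof -
  let ?A = "Poly_Mapping.keys f \<union> Poly_Mapping.keys g"
  have "Poly_Mapping.keys (f + g) \<subseteq> ?A" by (rule keys_add)
  then show ?thesis
    by (simp add: lin_ext_superset[of ?A] lookup_add pm_scale_add_left sum.distrib)
qed

lemma lin_ext_scale: "lin_ext h (pm_scale c f) = pm_scale c (lin_ext h f)"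
proof -
  have "Poly_Mapping.keys (pm_scale c f) \<subseteq> Poly_Mapping.keys f"
    by (auto simp: in_keys_iff)
  then show ?thesis
    by (simp add: lin_ext_superset[of "Poly_Mapping.keys f"] pm_scale_sum)
qed

lemma lin_ext_sum: "lin_ext h (sum f A) = (\<Sum>x\<in>A. lin_ext h (f x))"
  by (induction A rule: infinite_finite_induct) (auto simp: lin_ext_add)

lemma lin_ext_fun_add: "lin_ext (\<lambda>w. h w + h' w) f = lin_ext h f + lin_ext h' f"
  by (simp add: lin_ext_def pm_scale_add sum.distrib)

lemma lin_ext_fun_scale: "lin_ext (\<lambda>w. pm_scale c (h w)) f = pm_scale c (lin_ext h f)"
  by (simp add: lin_ext_def pm_scale_sum mult.commute)


section \<open>Direct sums of subspaces\<close>

text \<open>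
  \<open>W\<close> is the internal direct sum of the subspaces \<open>A i\<close>, \<open>i \<in> I\<close>. The index set may be infinite:
  every element of \<open>W\<close> has a unique expression as a finitely supported sum.
\<close>

definition direct_sum ::
  "('k::field \<Rightarrow> 'v::ab_group_add \<Rightarrow> 'v) \<Rightarrow> 'i set \<Rightarrow> ('i \<Rightarrow> 'v set) \<Rightarrow> 'v set \<Rightarrow> bool"
  where "direct_sum scale I A W \<longleftrightarrow>
    module.subspace scale W \<and>
    (\<forall>i\<in>I. module.subspace scale (A i) \<and> A i \<subseteq> W) \<and>
    (\<forall>w\<in>W. \<exists>!x. (\<forall>i\<in>I. x i \<in> A i) \<and> (\<forall>i. i \<notin> I \<longrightarrow> x i = 0) \<and>
      finite {i. x i \<noteq> 0} \<and> w = (\<Sum>i | x i \<noteq> 0. x i))"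


section \<open>The Lie algebra \<open>\<gg>\<^sub>a\<close> and its modules\<close>

text \<open>\<open>\<bbbK>\<^sup>N\<close> is the space of families supported in \<open>{1..N}\<close>.\<close>

definition KN :: "nat \<Rightarrow> (nat \<Rightarrow>\<^sub>0 'k::field) set"
  where "KN N = {u. Poly_Mapping.keys u \<subseteq> {1..N}}"

definition eps :: "nat \<Rightarrow> (nat \<Rightarrow>\<^sub>0 'k::field)"
  where "eps i = Poly_Mapping.single i 1"

definition ga_bracket ::
  "nat \<Rightarrow> (nat \<Rightarrow>\<^sub>0 'k::field) \<Rightarrow> (nat \<Rightarrow>\<^sub>0 'k) \<Rightarrow> (nat \<Rightarrow>\<^sub>0 'k) \<Rightarrow> (nat \<Rightarrow>\<^sub>0 'k)"
  where "ga_bracket N a u v =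
    (\<Sum>i\<in>{1..N}. \<Sum>j\<in>{1..N}.
       pm_scale (Poly_Mapping.lookup u i * Poly_Mapping.lookup v j)
         (pm_scale (Poly_Mapping.lookup a j) (eps i) - pm_scale (Poly_Mapping.lookup a i) (eps j)))"

definition ga_module ::
  "nat \<Rightarrow> (nat \<Rightarrow>\<^sub>0 'k::field) \<Rightarrow> ('k \<Rightarrow> 'v::ab_group_add \<Rightarrow> 'v) \<Rightarrow>
    ((nat \<Rightarrow>\<^sub>0 'k) \<Rightarrow> 'v \<Rightarrow> 'v) \<Rightarrow> bool"
  where "ga_module N a scale act \<longleftrightarrow>
    (\<forall>u\<in>KN N. Vector_Spaces.linear scale scale (act u)) \<and>
    (\<forall>u\<in>KN N. \<forall>v\<in>KN N. \<forall>x. act (u + v) x = act u x + act v x) \<and>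
    (\<forall>c. \<forall>u\<in>KN N. \<forall>x. act (pm_scale c u) x = scale c (act u x)) \<and>
    (\<forall>u\<in>KN N. \<forall>v\<in>KN N. \<forall>x. act (ga_bracket N a u v) x = act u (act v x) - act v (act u x))"

definition submodule ::
  "nat \<Rightarrow> ('k::field \<Rightarrow> 'v::ab_group_add \<Rightarrow> 'v) \<Rightarrow> ((nat \<Rightarrow>\<^sub>0 'k) \<Rightarrow> 'v \<Rightarrow> 'v) \<Rightarrow> 'v set \<Rightarrow> bool"
  where "submodule N scale act U \<longleftrightarrow>
    module.subspace scale U \<and> (\<forall>u\<in>KN N. \<forall>x\<in>U. act u x \<in> U)"

definition indecomposable ::
  "nat \<Rightarrow> ('k::field \<Rightarrow> 'v::ab_group_add \<Rightarrow> 'v) \<Rightarrow> ((nat \<Rightarrow>\<^sub>0 'k) \<Rightarrow> 'v \<Rightarrow> 'v) \<Rightarrow> 'v set \<Rightarrow> bool"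
  where "indecomposable N scale act U \<longleftrightarrow>
    submodule N scale act U \<and> U \<noteq> {0} \<and>
    \<not> (\<exists>A B. submodule N scale act A \<and> submodule N scale act B \<and> A \<noteq> {0} \<and> B \<noteq> {0} \<and>
         A \<inter> B = {0} \<and> U = {x + y |x y. x \<in> A \<and> y \<in> B})"

text \<open>
  A decomposition \<open>U = U\<^sup>(\<^sup>0\<^sup>) \<oplus> \<dots> \<oplus> U\<^sup>(\<^sup>k\<^sup>)\<close>, \<open>U\<^sup>(\<^sup>p\<^sup>) = D p\<close>, in generalized eigenspaces of
  \<open>\<epsilon>\<^sub>1\<close> for \<open>l, l + 1, \<dots>, l + k\<close>, lowered by one by the other \<open>\<epsilon>\<^sub>i\<close>.
  By convention \<open>D p\<close> is zero for \<open>p > k\<close>.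
\<close>

definition weight_decomposition ::
  "nat \<Rightarrow> ('k::field \<Rightarrow> 'v::ab_group_add \<Rightarrow> 'v) \<Rightarrow> ((nat \<Rightarrow>\<^sub>0 'k) \<Rightarrow> 'v \<Rightarrow> 'v) \<Rightarrow>
    'v set \<Rightarrow> 'k \<Rightarrow> nat \<Rightarrow> (nat \<Rightarrow> 'v set) \<Rightarrow> bool"
  where "weight_decomposition N scale act U l k D \<longleftrightarrow>
    direct_sum scale {0..k} D U \<and>
    (\<forall>p>k. D p = {0}) \<and>
    (\<forall>p\<le>k.
      (\<forall>x\<in>D p. act (eps 1) x \<in> D p) \<and>
      (\<exists>m. \<forall>x\<in>D p. ((\<lambda>y. act (eps 1) y - scale (l + of_nat p) y) ^^ m) x = 0) \<and>
      (\<forall>i\<in>{2..N}. \<forall>x\<in>D p. act (eps i) x \<in> (if p = 0 then {0} else D (p - 1))))"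


section \<open>The tensor algebra\<close>

text \<open>
  \<open>V\<close> is a finite-dimensional space, the whole type \<open>'v\<close> with scalar multiplication \<open>scale\<close>, and
  \<open>B\<close> is a basis of it. \<open>T(V)\<close> is the space with basis the words with letters in \<open>B\<close>. A word
  \<open>x\<^sub>1\<dots>x\<^sub>n\<close> in arbitrary vectors is the multilinear expansion in words of basis vectors:
  \<open>cat scale B x f\<close> is the product \<open>xf\<close> of the letter \<open>x \<in> V\<close> with \<open>f \<in> T(V)\<close>.
\<close>

definition TV :: "'v set \<Rightarrow> ('v list \<Rightarrow>\<^sub>0 'k::field) set"
  where "TV B = {f. Poly_Mapping.keys f \<subseteq> lists B}"

definition emptyw :: "'v list \<Rightarrow>\<^sub>0 'k::field"
  where "emptyw = Poly_Mapping.single [] 1"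

definition cat ::
  "('k::field \<Rightarrow> 'v::ab_group_add \<Rightarrow> 'v) \<Rightarrow> 'v set \<Rightarrow> 'v \<Rightarrow> ('v list \<Rightarrow>\<^sub>0 'k) \<Rightarrow> ('v list \<Rightarrow>\<^sub>0 'k)"
  where "cat scale B x f =
    (\<Sum>b\<in>B. lin_ext (\<lambda>w. Poly_Mapping.single (b # w) (module.representation scale B x b)) f)"

definition word ::
  "('k::field \<Rightarrow> 'v::ab_group_add \<Rightarrow> 'v) \<Rightarrow> 'v set \<Rightarrow> 'v list \<Rightarrow> ('v list \<Rightarrow>\<^sub>0 'k)"
  where "word scale B xs = foldr (cat scale B) xs emptyw"

function shuffle_words ::
  "('k::field \<Rightarrow> 'v::ab_group_add \<Rightarrow> 'v) \<Rightarrow> 'v set \<Rightarrow> 'v list \<Rightarrow> 'v list \<Rightarrow> ('v list \<Rightarrow>\<^sub>0 'k)"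
  where
    "shuffle_words scale B [] w = Poly_Mapping.single w 1"
  | "shuffle_words scale B (b # v) [] = Poly_Mapping.single (b # v) 1"
  | "shuffle_words scale B (b # v) (c # w) =
       cat scale B b (shuffle_words scale B v (c # w)) +
       cat scale B c (shuffle_words scale B (b # v) w)"
  by pat_completeness auto
termination by (relation "measure (\<lambda>(_, _, v, w). length v + length w)") auto

definition sh ::
  "('k::field \<Rightarrow> 'v::ab_group_add \<Rightarrow> 'v) \<Rightarrow> 'v set \<Rightarrow>
    ('v list \<Rightarrow>\<^sub>0 'k) \<Rightarrow> ('v list \<Rightarrow>\<^sub>0 'k) \<Rightarrow> ('v list \<Rightarrow>\<^sub>0 'k)"
  where "sh scale B f g = lin_ext (\<lambda>v. lin_ext (\<lambda>w. shuffle_words scale B v w) g) f"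


section \<open>The operations on \<open>T(V)\<^sup>N\<close>\<close>

text \<open>The element \<open>f \<epsilon>\<^sub>i\<close> is \<open>Poly_Mapping.single i f\<close>.\<close>

definition TVN :: "nat \<Rightarrow> 'v set \<Rightarrow> (nat \<Rightarrow>\<^sub>0 ('v list \<Rightarrow>\<^sub>0 'k::field)) set"
  where "TVN N B = {u. Poly_Mapping.keys u \<subseteq> {1..N} \<and> (\<forall>i. Poly_Mapping.lookup u i \<in> TV B)}"

definition bracket ::
  "nat \<Rightarrow> (nat \<Rightarrow>\<^sub>0 'k::field) \<Rightarrow> ('k \<Rightarrow> 'v::ab_group_add \<Rightarrow> 'v) \<Rightarrow> 'v set \<Rightarrow>
    (nat \<Rightarrow>\<^sub>0 ('v list \<Rightarrow>\<^sub>0 'k)) \<Rightarrow> (nat \<Rightarrow>\<^sub>0 ('v list \<Rightarrow>\<^sub>0 'k)) \<Rightarrow> (nat \<Rightarrow>\<^sub>0 ('v list \<Rightarrow>\<^sub>0 'k))"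
  where "bracket N a scale B u v =
    (\<Sum>i\<in>{1..N}. \<Sum>j\<in>{1..N}.
      let s = sh scale B (Poly_Mapping.lookup u i) (Poly_Mapping.lookup v j) in
        Poly_Mapping.single j (pm_scale (Poly_Mapping.lookup a i) s) -
        Poly_Mapping.single i (pm_scale (Poly_Mapping.lookup a j) s))"

text \<open>
  \<open>w\<epsilon>\<^sub>i * g\<epsilon>\<^sub>j = (star_word scale B F\<^sub>j w g)\<epsilon>\<^sub>i\<close> for a word \<open>w\<close> of basis vectors; the inductive rule
  for a letter \<open>x \<in> V\<close> and \<open>f \<in> T(V)\<close> is \<open>star_single_cat\<close> below.
\<close>

fun star_word ::
  "('k::field \<Rightarrow> 'v::ab_group_add \<Rightarrow> 'v) \<Rightarrow> 'v set \<Rightarrow> ('v \<Rightarrow> 'v) \<Rightarrow>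
    'v list \<Rightarrow> ('v list \<Rightarrow>\<^sub>0 'k) \<Rightarrow> ('v list \<Rightarrow>\<^sub>0 'k)"
  where
    "star_word scale B Fj [] g = 0"
  | "star_word scale B Fj (b # w) g =
       cat scale B b (star_word scale B Fj w g) +
       cat scale B (Fj b) (sh scale B (Poly_Mapping.single w 1) g)"

definition star ::
  "nat \<Rightarrow> ('k::field \<Rightarrow> 'v::ab_group_add \<Rightarrow> 'v) \<Rightarrow> 'v set \<Rightarrow> ((nat \<Rightarrow>\<^sub>0 'k) \<Rightarrow> 'v \<Rightarrow> 'v) \<Rightarrow>
    (nat \<Rightarrow>\<^sub>0 ('v list \<Rightarrow>\<^sub>0 'k)) \<Rightarrow> (nat \<Rightarrow>\<^sub>0 ('v list \<Rightarrow>\<^sub>0 'k)) \<Rightarrow> (nat \<Rightarrow>\<^sub>0 ('v list \<Rightarrow>\<^sub>0 'k))"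
  where "star N scale B act u v =
    (\<Sum>i\<in>{1..N}. \<Sum>j\<in>{1..N}. Poly_Mapping.single i
      (lin_ext (\<lambda>w. star_word scale B (act (eps j)) w (Poly_Mapping.lookup v j))
        (Poly_Mapping.lookup u i)))"


section \<open>The grading\<close>

text \<open>
  \<open>\<U>\<close> is the finite set of summands of \<open>V\<close>, with \<open>D U p = U\<^sup>(\<^sup>p\<^sup>)\<close> and \<open>kk U = k\<^sub>U\<close>.
\<close>

definition V_weight :: "'v::ab_group_add set set \<Rightarrow> ('v set \<Rightarrow> nat \<Rightarrow> 'v set) \<Rightarrow> nat \<Rightarrow> 'v set"
  where "V_weight \<U> D p = {\<Sum>U\<in>\<U>. x U |x. \<forall>U\<in>\<U>. x U \<in> D U p}"

definition top_weight :: "'v set set \<Rightarrow> ('v set \<Rightarrow> nat) \<Rightarrow> nat"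
  where "top_weight \<U> kk = Max (insert 0 (kk ` \<U>))"

definition V_grade ::
  "'v::ab_group_add set set \<Rightarrow> ('v set \<Rightarrow> nat) \<Rightarrow> ('v set \<Rightarrow> nat \<Rightarrow> 'v set) \<Rightarrow> nat \<Rightarrow> 'v set"
  where "V_grade \<U> kk D p =
    (if p \<in> {1..top_weight \<U> kk + 1} then V_weight \<U> D (top_weight \<U> kk + 1 - p) else {0})"

definition T_grade ::
  "('k::field \<Rightarrow> 'v::ab_group_add \<Rightarrow> 'v) \<Rightarrow> 'v set \<Rightarrow> (nat \<Rightarrow> 'v set) \<Rightarrow> nat \<Rightarrow>
    ('v list \<Rightarrow>\<^sub>0 'k) set"
  where "T_grade scale B Vg n =
    module.span pm_scale
      {word scale B xs |xs ps. list_all2 (\<lambda>x p. p \<ge> 1 \<and> x \<in> Vg p) xs ps \<and> sum_list ps = n}"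

definition g_grade ::
  "nat \<Rightarrow> ('k::field \<Rightarrow> 'v::ab_group_add \<Rightarrow> 'v) \<Rightarrow> 'v set \<Rightarrow> (nat \<Rightarrow> 'v set) \<Rightarrow> nat \<Rightarrow>
    (nat \<Rightarrow>\<^sub>0 ('v list \<Rightarrow>\<^sub>0 'k)) set"
  where "g_grade N scale B Vg n =
    {u \<in> TVN N B. Poly_Mapping.lookup u 1 \<in> T_grade scale B Vg n \<and>
      (\<forall>i\<in>{2..N}. Poly_Mapping.lookup u i \<in> (if n = 0 then {0} else T_grade scale B Vg (n - 1)))}"


section \<open>The defining rules of the operations\<close>

lemma bracket_single:
  assumes "i \<in> {1..N}" "j \<in> {1..N}"
  shows "bracket N a scale B (Poly_Mapping.single i f) (Poly_Mapping.single j g) =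
    Poly_Mapping.single j (pm_scale (Poly_Mapping.lookup a i) (sh scale B f g)) -
    Poly_Mapping.single i (pm_scale (Poly_Mapping.lookup a j) (sh scale B f g))"
proof -
  have [simp]: "sh scale B 0 y = 0" "sh scale B y 0 = 0" for y
    by (auto simp: sh_def lin_ext_def)
  let ?t = "Poly_Mapping.single j (pm_scale (Poly_Mapping.lookup a i) (sh scale B f g)) -
    Poly_Mapping.single i (pm_scale (Poly_Mapping.lookup a j) (sh scale B f g))"
  have "bracket N a scale B (Poly_Mapping.single i f) (Poly_Mapping.single j g) =
    (\<Sum>i'\<in>{1..N}. \<Sum>j'\<in>{1..N}. if j = j' then (if i = i' then ?t else 0) else 0)"
    unfolding bracket_def Let_def
    by (intro sum.cong refl) (auto simp: lookup_single when_def)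
  also have "\<dots> = ?t"
    using assms by (simp add: sum.delta)
  finally show ?thesis .
qed

context finite_dimensional_vector_space
begin

lemma cat_add: "cat scale Basis x (f + g) = cat scale Basis x f + cat scale Basis x g"
  by (simp add: cat_def lin_ext_add sum.distrib)

lemma cat_scale: "cat scale Basis x (pm_scale c f) = pm_scale c (cat scale Basis x f)"
  by (simp add: cat_def lin_ext_scale pm_scale_sum)

lemma cat_add_left: "cat scale Basis (x + y) f = cat scale Basis x f + cat scale Basis y f"
  by (simp add: cat_def representation_add independent_Basis span_Basis single_add
      lin_ext_fun_add sum.distrib)

lemma cat_scale_left: "cat scale Basis (scale c x) f = pm_scale c (cat scale Basis x f)"
proof -
  have "lin_ext (\<lambda>w. Poly_Mapping.single (b # w) (c * r)) f =
    pm_scale c (lin_ext (\<lambda>w. Poly_Mapping.single (b # w) r) f)" for b :: 'b and r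
    using lin_ext_fun_scale[of c "\<lambda>w. Poly_Mapping.single (b # w) r" f] by simp
  then show ?thesis
    by (simp add: cat_def representation_scale independent_Basis span_Basis pm_scale_sum)
qed

lemma cat_0 [simp]: "cat scale Basis x 0 = 0" "cat scale Basis 0 f = 0"
  using cat_scale[of x 0 0] cat_scale_left[of 0 0 f] by simp_all

lemma cat_sum_left: "cat scale Basis (sum h A) f = (\<Sum>a\<in>A. cat scale Basis (h a) f)"
  by (induction A rule: infinite_finite_induct) (auto simp: cat_add_left)

lemma cat_lin_ext: "cat scale Basis x (lin_ext h f) = lin_ext (\<lambda>w. cat scale Basis x (h w)) f"
proof -
  have "cat scale Basis x (sum g A) = (\<Sum>w\<in>A. cat scale Basis x (g w))" for g and A :: "'c set"
    by (induction A rule: infinite_finite_induct) (auto simp: cat_add)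
  then show ?thesis by (simp add: lin_ext_def cat_scale)
qed

lemma cat_Basis:
  assumes "b \<in> Basis"
  shows "cat scale Basis b f = lin_ext (\<lambda>w. Poly_Mapping.single (b # w) 1) f"
proof -
  have "cat scale Basis b f =
    (\<Sum>c\<in>Basis. if b = c then lin_ext (\<lambda>w. Poly_Mapping.single (b # w) 1) f else 0)"
    unfolding cat_def
    by (intro sum.cong refl)
      (auto simp: representation_basis independent_Basis assms, simp add: lin_ext_def)
  then show ?thesis by (simp add: finite_Basis assms)
qed

lemma cat_Basis_single:
  "b \<in> Basis \<Longrightarrow> cat scale Basis b (Poly_Mapping.single w c) = Poly_Mapping.single (b # w) c"
  by (simp add: cat_Basis)

lemma word_Basis:
  "set w \<subseteq> Basis \<Longrightarrow> word scale Basis w = Poly_Mapping.single w 1"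
  by (induction w) (simp_all add: word_def emptyw_def cat_Basis_single)

lemma sum_representation: "(\<Sum>b\<in>Basis. scale (representation Basis x b) b) = x"
proof -
  have "(\<Sum>b\<in>Basis. scale (representation Basis x b) b) =
      (\<Sum>b | representation Basis x b \<noteq> 0. scale (representation Basis x b) b)"
    by (rule sum.mono_neutral_right)
      (use finite_Basis representation_ne_zero in auto)
  then show ?thesis
    by (simp add: sum_nonzero_representation_eq independent_Basis span_Basis)
qed

lemma bilinear_cat_eqI:
  assumes add: "\<And>x y. L (x + y) = L x + L y" "\<And>x y. R (x + y) = R x + R y"
    and scl: "\<And>c x. L (scale c x) = pm_scale c (L x)" "\<And>c x. R (scale c x) = pm_scale c (R x)"
    and Basis: "\<And>b. b \<in> Basis \<Longrightarrow> L b = R b"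
  shows "L x = R x"
proof -
  have 0: "L 0 = 0" "R 0 = 0" using scl[of 0 0] by simp_all
  have "L (\<Sum>b\<in>A. h b) = (\<Sum>b\<in>A. L (h b))" "R (\<Sum>b\<in>A. h b) = (\<Sum>b\<in>A. R (h b))"
    for h and A :: "'b set"
    by (induction A rule: infinite_finite_induct) (auto simp: add 0)
  note s = this
  have "L (\<Sum>b\<in>Basis. scale (representation Basis x b) b) =
    R (\<Sum>b\<in>Basis. scale (representation Basis x b) b)"
    unfolding s scl by (intro sum.cong refl) (simp add: Basis)
  then show ?thesis by (simp add: sum_representation)
qed

lemma sh_add: "sh scale Basis (f + f') g = sh scale Basis f g + sh scale Basis f' g"
  by (simp add: sh_def lin_ext_add)

lemma sh_scale: "sh scale Basis (pm_scale c f) g = pm_scale c (sh scale Basis f g)"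
  by (simp add: sh_def lin_ext_scale)

lemma sh_add_right: "sh scale Basis f (g + g') = sh scale Basis f g + sh scale Basis f g'"
  by (simp add: sh_def lin_ext_add lin_ext_fun_add)

lemma sh_scale_right: "sh scale Basis f (pm_scale c g) = pm_scale c (sh scale Basis f g)"
  by (simp add: sh_def lin_ext_scale lin_ext_fun_scale)

lemma lin_ext_eqI:
  assumes add: "\<And>f g. L (f + g) = L f + L g" "\<And>f g. R (f + g) = R f + R g"
    and scl: "\<And>c f. L (pm_scale c f) = pm_scale c (L f)" "\<And>c f. R (pm_scale c f) = pm_scale c (R f)"
    and single: "\<And>w. L (Poly_Mapping.single w 1) = R (Poly_Mapping.single w 1)"
  shows "L f = R f"
proof -
  have 0: "L 0 = 0" "R 0 = 0" using scl[of 0 0] by simp_all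
  have "L (sum h A) = (\<Sum>w\<in>A. L (h w))" "R (sum h A) = (\<Sum>w\<in>A. R (h w))" for h and A :: "'c set"
    by (induction A rule: infinite_finite_induct) (auto simp: add 0)
  note s = this
  have f: "f = lin_ext (\<lambda>w. Poly_Mapping.single w 1) f"
    by (rule poly_mapping_eqI)
      (auto simp: lin_ext_def lookup_sum lookup_single when_def in_keys_iff)
  have "L (lin_ext (\<lambda>w. Poly_Mapping.single w 1) f) = R (lin_ext (\<lambda>w. Poly_Mapping.single w 1) f)"
    unfolding lin_ext_def s scl single ..
  then show ?thesis using f by simp
qed

lemma sh_emptyw_left: "sh scale Basis emptyw g = g"
  by (rule lin_ext_eqI[of "sh scale Basis emptyw" "\<lambda>g. g"])
    (simp_all add: sh_add_right sh_scale_right, simp add: sh_def emptyw_def)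

lemma sh_emptyw_right: "sh scale Basis f emptyw = f"
proof (rule lin_ext_eqI[of "\<lambda>f. sh scale Basis f emptyw" "\<lambda>f. f"])
  show "sh scale Basis (Poly_Mapping.single w 1) emptyw = Poly_Mapping.single w 1" for w
    by (cases w) (simp_all add: sh_def emptyw_def)
qed (simp_all add: sh_add sh_scale)

lemma sh_cat_cat:
  "sh scale Basis (cat scale Basis x f) (cat scale Basis y g) =
    cat scale Basis x (sh scale Basis f (cat scale Basis y g)) +
    cat scale Basis y (sh scale Basis (cat scale Basis x f) g)" (is "?L x f y g = ?R x f y g")
proof -
  note lin = sh_add sh_scale sh_add_right sh_scale_right cat_add cat_scale cat_add_left
    cat_scale_left pm_scale_add algebra_simps
  have 1: "?L b (Poly_Mapping.single v 1) c (Poly_Mapping.single w 1) =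
      ?R b (Poly_Mapping.single v 1) c (Poly_Mapping.single w 1)"
    if "b \<in> Basis" "c \<in> Basis" for b c v w
    using that by (simp add: cat_Basis_single) (simp add: sh_def)
  have 2: "?L b (Poly_Mapping.single v 1) c g = ?R b (Poly_Mapping.single v 1) c g"
    if "b \<in> Basis" "c \<in> Basis" for b c v
    by (rule lin_ext_eqI[of "\<lambda>g. ?L b (Poly_Mapping.single v 1) c g"
          "\<lambda>g. ?R b (Poly_Mapping.single v 1) c g"]) (simp_all add: lin, use 1 that in simp)
  have 3: "?L b f c g = ?R b f c g"
    if "b \<in> Basis" "c \<in> Basis" for b c
    by (rule lin_ext_eqI[of "\<lambda>f. ?L b f c g" "\<lambda>f. ?R b f c g"])
      (simp_all add: lin, use 2 that in simp)
  have 4: "?L x f c g = ?R x f c g" if "c \<in> Basis" for c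
    by (rule bilinear_cat_eqI[of "\<lambda>x. ?L x f c g" "\<lambda>x. ?R x f c g"])
      (simp_all add: lin, use 3 that in simp)
  show ?thesis
    by (rule bilinear_cat_eqI[of "\<lambda>y. ?L x f y g" "\<lambda>y. ?R x f y g"])
      (simp_all add: lin, use 4 in simp)
qed

lemma star_single:
  assumes "i \<in> {1..N}" "j \<in> {1..N}"
  shows "star N scale Basis act (Poly_Mapping.single i f) (Poly_Mapping.single j g) =
    Poly_Mapping.single i (lin_ext (\<lambda>w. star_word scale Basis (act (eps j)) w g) f)"
proof -
  have sh0 [simp]: "sh scale Basis f 0 = 0" for f
    by (simp add: sh_def lin_ext_def)
  have [simp]: "star_word scale Basis Fj w 0 = 0" for Fj w
    by (induction w) simp_all
  have [simp]: "lin_ext (\<lambda>w. 0) f = (0 :: 'b list \<Rightarrow>\<^sub>0 'a)" for f :: "'b list \<Rightarrow>\<^sub>0 'a"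
    by (simp add: lin_ext_def)
  let ?t = "Poly_Mapping.single i (lin_ext (\<lambda>w. star_word scale Basis (act (eps j)) w g) f)"
  have "star N scale Basis act (Poly_Mapping.single i f) (Poly_Mapping.single j g) =
    (\<Sum>i'\<in>{1..N}. \<Sum>j'\<in>{1..N}. if j = j' then (if i = i' then ?t else 0) else 0)"
    unfolding star_def by (intro sum.cong refl) (auto simp: lookup_single when_def)
  also have "\<dots> = ?t"
    using assms by (simp add: sum.delta)
  finally show ?thesis .
qed

lemma star_single_emptyw:
  assumes "i \<in> {1..N}" "j \<in> {1..N}"
  shows "star N scale Basis act (Poly_Mapping.single i emptyw) (Poly_Mapping.single j g) = 0"
  by (simp add: star_single[OF assms] emptyw_def)

lemma star_single_cat:
  assumes "i \<in> {1..N}" "j \<in> {1..N}" and F: "Vector_Spaces.linear scale scale (act (eps j))"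
    and h: "star N scale Basis act (Poly_Mapping.single i f) (Poly_Mapping.single j g) =
      Poly_Mapping.single i h"
  shows "star N scale Basis act (Poly_Mapping.single i (cat scale Basis x f)) (Poly_Mapping.single j g) =
      Poly_Mapping.single i
        (cat scale Basis x h + cat scale Basis (act (eps j) x) (sh scale Basis f g))"
proof -
  interpret F: Vector_Spaces.linear scale scale "act (eps j)" by (rule F)
  let ?s = "lin_ext (\<lambda>w. star_word scale Basis (act (eps j)) w g)"
  let ?L = "\<lambda>x f. ?s (cat scale Basis x f)"
  let ?R = "\<lambda>x f. cat scale Basis x (?s f) + cat scale Basis (act (eps j) x) (sh scale Basis f g)"
  note lin = lin_ext_add lin_ext_scale F.add F.scale sh_add sh_scale cat_add cat_scale
    cat_add_left cat_scale_left pm_scale_add algebra_simps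
  have 1: "?L b f = ?R b f" if "b \<in> Basis" for b
    by (rule lin_ext_eqI[of "?L b" "?R b"]) (simp_all add: lin cat_Basis_single that)
  have "?L x f = ?R x f"
    by (rule bilinear_cat_eqI[of "\<lambda>x. ?L x f" "\<lambda>x. ?R x f"])
      (simp_all add: lin, use 1 in simp)
  moreover have "?s f = h"
    using h unfolding star_single[OF assms(1,2)] by (metis lookup_single_eq)
  ultimately show ?thesis
    by (simp add: star_single[OF assms(1,2)])
qed

end

end

theory Submission
  imports Defs
begin

text \<open>
  The weight spaces of the summands give a grading of \<open>V\<close> in positive degrees, and the projections
  of \<open>V\<close> onto its components extend letter by letter to projections of \<open>T(V)\<close> onto the spaces
  \<open>T(V)\<^sub>n\<close>; this makes the sum of the latter direct although the letters of a word in the fixed basis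
  need not be homogeneous. The shuffle product adds degrees. Reversing the weights makes \<open>F\<^sub>1\<close>
  homogeneous of degree 0 and the other \<open>F\<^sub>j\<close> of degree 1, which is exactly the shift by one of the
  components \<open>\<epsilon>\<^sub>j\<close>, \<open>j \<ge> 2\<close>. For the bracket, \<open>a = (1,0,\<dots>,0)\<close> leaves only the terms in which exactly
  one of the two indices is 1, so that the shift occurs once on either side.
\<close>

section \<open>Direct sums\<close>

context vector_space
begin

lemma direct_sum_subspace:
  "direct_sum scale I A W \<Longrightarrow> i \<in> I \<Longrightarrow> subspace (A i)"
  by (auto simp: direct_sum_def)

lemma direct_sum_subset_span:
  assumes "direct_sum scale I A W"
  shows "W \<subseteq> span (\<Union>i\<in>I. A i)"
proof
  fix w assume "w \<in> W"
  then obtain x where x: "\<forall>i\<in>I. x i \<in> A i" "\<forall>i. i \<notin> I \<longrightarrow> x i = 0" "w = (\<Sum>i | x i \<noteq> 0. x i)"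
    using assms unfolding direct_sum_def by blast
  have "(\<Sum>i | x i \<noteq> 0. x i) \<in> span (\<Union>i\<in>I. A i)"
    by (rule span_sum, rule span_base) (use x in blast)
  then show "w \<in> span (\<Union>i\<in>I. A i)"
    using x by simp
qed

text \<open>The reindexing \<open>\<sigma>\<close> accounts for the degree shifts between the various gradings.\<close>

lemma direct_sum_indep:
  assumes ds: "direct_sum scale I A W" and J: "finite J" and \<sigma>: "inj_on \<sigma> J" "\<sigma> ` J \<subseteq> I"
    and x: "\<And>j. j \<in> J \<Longrightarrow> x j \<in> A (\<sigma> j)" and 0: "sum x J = 0" and j: "j \<in> J"
  shows "x j = 0"
proof -
  \<comment> \<open>The family \<open>x\<close> is transported along \<open>\<sigma>\<close> and
    extended by 0. The result and the zero family both decompose 0, so uniqueness makes them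
    equal.\<close>
  define y where "y i = (if i \<in> \<sigma> ` J then x (the_inv_into J \<sigma> i) else 0)" for i
  have y\<sigma>: "y (\<sigma> k) = x k" if "k \<in> J" for k
    using that \<sigma>(1) by (simp add: y_def the_inv_into_f_f)
  have A0: "0 \<in> A i" if "i \<in> I" for i
    using direct_sum_subspace[OF ds that] subspace_0 by blast
  have supp: "{i. y i \<noteq> 0} \<subseteq> \<sigma> ` J"
    by (auto simp: y_def)
  have "(\<Sum>i | y i \<noteq> 0. y i) = sum y (\<sigma> ` J)"
    by (rule sum.mono_neutral_left) (use J supp in auto)
  also have "\<dots> = sum x J"
    using \<sigma>(1) y\<sigma> by (simp add: sum.reindex)
  finally have ysum: "0 = (\<Sum>i | y i \<noteq> 0. y i)"
    using 0 by simp
  define Q where "Q x \<longleftrightarrow> (\<forall>i\<in>I. x i \<in> A i) \<and> (\<forall>i. i \<notin> I \<longrightarrow> x i = 0) \<and>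
      finite {i. x i \<noteq> 0} \<and> 0 = (\<Sum>i | x i \<noteq> 0. x i)" for x
  have "0 \<in> W"
    using ds subspace_0 unfolding direct_sum_def by blast
  then have "\<exists>!x. Q x"
    using ds unfolding direct_sum_def Q_def by blast
  moreover have "Q y"
    unfolding Q_def using y\<sigma> x A0 \<sigma>(2) ysum finite_subset[OF supp] J by (auto simp: y_def)
  moreover have "Q (\<lambda>i. 0)"
    using A0 by (simp add: Q_def)
  ultimately have "y = (\<lambda>i. 0)"
    by blast
  then show ?thesis
    using y\<sigma>[OF j] by simp
qed

text \<open>Because each \<open>A i\<close> is a subspace, the contributions to a linear combination
  that come from the same \<open>A i\<close> merge, leaving one summand per index.\<close>

lemma span_UN_subspaces:
  assumes sub: "\<And>i. i \<in> I \<Longrightarrow> subspace (A i)" and w: "w \<in> span (\<Union>i\<in>I. A i)"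
  shows "\<exists>J x. finite J \<and> J \<subseteq> I \<and> (\<forall>i\<in>J. x i \<in> A i) \<and> w = sum x J"
  using w
proof (induction rule: span_induct_alt)
  case base
  show ?case by (rule exI[of _ "{}"]) simp
next
  case (step c a w)
  then obtain i J x where i: "i \<in> I" "a \<in> A i" and
    J: "finite J" "J \<subseteq> I" "\<forall>i\<in>J. x i \<in> A i" "w = sum x J" by blast
  define y where "y = (\<lambda>k. if k = i then scale c a + (if i \<in> J then x i else 0) else x k)"
  have "scale c a + w = sum y (insert i J)"
  proof (cases "i \<in> J")
    case True
    then have "sum y (insert i J) = y i + sum y (J - {i})"
      using J by (simp add: insert_absorb sum.remove)
    also have "sum y (J - {i}) = sum x (J - {i})"
      by (rule sum.cong) (auto simp: y_def)
    finally show ?thesis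
      using True J by (simp add: y_def sum.remove[of J i])
  next
    case False
    then have "sum y J = sum x J"
      by (intro sum.cong) (auto simp: y_def)
    then show ?thesis using False J by (simp add: y_def)
  qed
  moreover have "\<forall>k\<in>insert i J. y k \<in> A k"
    using J i sub[OF i(1)] by (auto simp: y_def subspace_add subspace_scale)
  ultimately show ?case
    using J i by (intro exI[of _ "insert i J"] exI[of _ y]) auto
qed

text \<open>Spanning gives the existence of decompositions. Two decompositions of the same vector
  are compared on the union of their supports, where independence kills their differences. All three
  gradings are established through this criterion.\<close>

lemma direct_sumI:
  assumes W: "subspace W" and sub: "\<And>i. i \<in> I \<Longrightarrow> subspace (A i)" "\<And>i. i \<in> I \<Longrightarrow> A i \<subseteq> W"
    and span: "W \<subseteq> span (\<Union>i\<in>I. A i)"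
    and indep: "\<And>J x j. finite J \<Longrightarrow> J \<subseteq> I \<Longrightarrow> (\<And>i. i \<in> J \<Longrightarrow> x i \<in> A i) \<Longrightarrow> sum x J = 0 \<Longrightarrow>
      j \<in> J \<Longrightarrow> x j = 0"
  shows "direct_sum scale I A W"
  unfolding direct_sum_def
proof (intro conjI ballI ex_ex1I)
  fix w assume "w \<in> W"
  then obtain J x where J: "finite J" "J \<subseteq> I" "\<forall>i\<in>J. x i \<in> A i" "w = sum x J"
    using span_UN_subspaces[of I A w] sub(1) span by (metis subsetD)
  define y where "y = (\<lambda>i. if i \<in> J then x i else 0)"
  have "\<forall>i\<in>I. y i \<in> A i"
    using J sub(1) subspace_0 by (auto simp: y_def)
  moreover have supp: "{i. y i \<noteq> 0} \<subseteq> J"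
    by (auto simp: y_def)
  moreover have "(\<Sum>i | y i \<noteq> 0. y i) = sum y J"
    by (rule sum.mono_neutral_left) (use supp J in auto)
  then have "w = (\<Sum>i | y i \<noteq> 0. y i)"
    using J by (simp add: y_def)
  ultimately show "\<exists>x. (\<forall>i\<in>I. x i \<in> A i) \<and> (\<forall>i. i \<notin> I \<longrightarrow> x i = 0) \<and>
      finite {i. x i \<noteq> 0} \<and> w = (\<Sum>i | x i \<noteq> 0. x i)"
    using J finite_subset[OF supp] by (intro exI[of _ y]) (auto simp: y_def)
next
  fix w x y
  assume x: "(\<forall>i\<in>I. x i \<in> A i) \<and> (\<forall>i. i \<notin> I \<longrightarrow> x i = 0) \<and>
      finite {i. x i \<noteq> 0} \<and> w = (\<Sum>i | x i \<noteq> 0. x i)"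
    and y: "(\<forall>i\<in>I. y i \<in> A i) \<and> (\<forall>i. i \<notin> I \<longrightarrow> y i = 0) \<and>
      finite {i. y i \<noteq> 0} \<and> w = (\<Sum>i | y i \<noteq> 0. y i)"
  define J where "J = {i. x i \<noteq> 0} \<union> {i. y i \<noteq> 0}"
  have J: "finite J" "J \<subseteq> I" using x y by (auto simp: J_def)
  have "(\<Sum>i | x i \<noteq> 0. x i) = sum x J" "(\<Sum>i | y i \<noteq> 0. y i) = sum y J"
    by (rule sum.mono_neutral_left; use J in \<open>auto simp: J_def\<close>)+
  then have "w = sum x J" "w = sum y J"
    using x y by simp_all
  then have "(\<Sum>i\<in>J. x i - y i) = 0"
    by (simp add: sum_subtractf)
  moreover have "x i - y i \<in> A i" if "i \<in> J" for i
    using that J x y by (intro subspace_diff sub(1)) auto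
  ultimately have "x i - y i = 0" if "i \<in> J" for i
    using indep[of J "\<lambda>i. x i - y i"] J that by blast
  then show "x = y"
    unfolding fun_eq_iff J_def by (metis (mono_tags) UnCI eq_iff_diff_eq_0 mem_Collect_eq)
qed (use W sub in auto)

text \<open>The coordinates of the unique decomposition are linear, because sums and multiples of
  decompositions are again decompositions.\<close>

lemma direct_sum_projections:
  assumes ds: "direct_sum scale I A UNIV"
  shows "\<exists>P. (\<forall>i x y. P i (x + y) = P i x + P i y) \<and>
    (\<forall>i c x. P i (scale c x) = scale c (P i x)) \<and>
    (\<forall>i\<in>I. \<forall>x\<in>A i. \<forall>j. P j x = (if i = j then x else 0))"
proof -
  note sub = direct_sum_subspace[OF ds]
  have "\<forall>w. \<exists>x. (\<forall>i\<in>I. x i \<in> A i) \<and> (\<forall>i. i \<notin> I \<longrightarrow> x i = 0) \<and>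
      finite {i. x i \<noteq> 0} \<and> w = (\<Sum>i | x i \<noteq> 0. x i)"
    using ds unfolding direct_sum_def by blast
  then obtain C where C: "\<forall>w. (\<forall>i\<in>I. C w i \<in> A i) \<and> (\<forall>i. i \<notin> I \<longrightarrow> C w i = 0) \<and>
      finite {i. C w i \<noteq> 0} \<and> w = (\<Sum>i | C w i \<noteq> 0. C w i)"
    by (elim choice[THEN exE])
  \<comment> \<open>Summing over any finite \<open>K\<close> that contains the support gives two
    vectors a common index set when they are added.\<close>
  have uniq: "C w = x"
    if x: "\<And>i. i \<in> I \<Longrightarrow> x i \<in> A i" "\<And>i. i \<notin> I \<Longrightarrow> x i = 0" "finite K" "{i. x i \<noteq> 0} \<subseteq> K"
      and w: "w = sum x K" for w x K
  proof -
    have "sum x K = (\<Sum>i | x i \<noteq> 0. x i)"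
      by (rule sum.mono_neutral_right) (use x in auto)
    moreover have "finite {i. x i \<noteq> 0}"
      using x finite_subset by blast
    ultimately have "(\<forall>i\<in>I. x i \<in> A i) \<and> (\<forall>i. i \<notin> I \<longrightarrow> x i = 0) \<and>
        finite {i. x i \<noteq> 0} \<and> w = (\<Sum>i | x i \<noteq> 0. x i)"
      using x w by simp
    moreover have "\<exists>!x. (\<forall>i\<in>I. x i \<in> A i) \<and> (\<forall>i. i \<notin> I \<longrightarrow> x i = 0) \<and>
        finite {i. x i \<noteq> 0} \<and> w = (\<Sum>i | x i \<noteq> 0. x i)"
      using ds unfolding direct_sum_def by blast
    ultimately show ?thesis
      using C[rule_format, of w] by blast
  qed
  have C_sum: "w = sum (C w) K" if "finite K" "{i. C w i \<noteq> 0} \<subseteq> K" for w K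
  proof -
    have "sum (C w) K = (\<Sum>i | C w i \<noteq> 0. C w i)"
      by (rule sum.mono_neutral_right) (use that in auto)
    then show ?thesis using C by metis
  qed
  show ?thesis
  proof (intro exI[of _ "\<lambda>i w. C w i"] conjI allI ballI)
    fix i x y
    let ?K = "{i. C x i \<noteq> 0} \<union> {i. C y i \<noteq> 0}"
    have "x = sum (C x) ?K" "y = sum (C y) ?K"
      by (rule C_sum; use C in auto)+
    then have "x + y = (\<Sum>i\<in>?K. C x i + C y i)"
      by (simp only: sum.distrib)
    then have "C (x + y) = (\<lambda>i. C x i + C y i)"
      using C sub by (intro uniq[of _ ?K]) (auto intro: subspace_add)
    then show "C (x + y) i = C x i + C y i" by simp
  next
    fix i c x
    let ?K = "{i. C x i \<noteq> 0}"
    have "x = sum (C x) ?K"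
      by (rule C_sum; use C in auto)
    then have "scale c x = (\<Sum>i\<in>?K. scale c (C x i))"
      by (metis scale_sum_right)
    then have "C (scale c x) = (\<lambda>i. scale c (C x i))"
      using C sub by (intro uniq[of _ ?K]) (auto intro: subspace_scale)
    then show "C (scale c x) i = scale c (C x i)" by simp
  next
    fix i x j assume "i \<in> I" "x \<in> A i"
    then have "C x = (\<lambda>k. if k = i then x else 0)"
      using sub subspace_0 by (intro uniq[of _ "{i}"]) auto
    then show "C x j = (if i = j then x else 0)" by simp
  qed
qed

end

section \<open>Linear maps and spans in spaces of finitely supported families\<close>

interpretation pm: vector_space pm_scale
  by (rule vector_space_pm_scale)

interpretation pm2: vector_space pm_scale2
  by (rule vector_space_pm_scale2)

text \<open>The graded pieces of \<open>T(V)\<close> are spans of words, so claims about linear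
  operations reduce to words, one argument at a time.\<close>

lemma linear_span_mem:
  assumes "Vector_Spaces.linear s s' L" "module.subspace s' S" "\<And>x. x \<in> G \<Longrightarrow> L x \<in> S"
    and "x \<in> module.span s G"
  shows "L x \<in> S"
proof -
  interpret Vector_Spaces.linear s s' L by fact
  have "vs2.span (L ` G) \<subseteq> S"
    using assms(2,3) by (intro vs2.span_minimal) auto
  then show ?thesis
    using assms(4) span_image[of G] by blast
qed

lemma linear_imp_zero: "Vector_Spaces.linear s s' L \<Longrightarrow> L 0 = 0"
  unfolding module_hom_iff_linear[symmetric] by (rule module_hom.zero)

lemma linear_lin_ext: "Vector_Spaces.linear pm_scale pm_scale (lin_ext h)"
  by unfold_locales (simp_all add: lin_ext_add lin_ext_scale pm_scale_add pm_scale_add_left)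

lemma lin_ext_mem:
  "pm.subspace S \<Longrightarrow> (\<And>w. w \<in> Poly_Mapping.keys f \<Longrightarrow> h w \<in> S) \<Longrightarrow> lin_ext h f \<in> S"
  unfolding lin_ext_def by (intro pm.subspace_sum pm.subspace_scale)

section \<open>The graded tensor algebra\<close>

lemma subspace_TV:
  fixes B :: "'v set"
  shows "pm.subspace (TV B :: ('v list \<Rightarrow>\<^sub>0 'k::field) set)"
proof (rule pm.subspaceI)
  fix f g :: "'v list \<Rightarrow>\<^sub>0 'k" and c
  show "f + g \<in> TV B" if "f \<in> TV B" "g \<in> TV B"
    using that keys_add[of f g] by (auto simp: TV_def)
  show "pm_scale c f \<in> TV B" if "f \<in> TV B"
  proof -
    have "Poly_Mapping.keys (pm_scale c f) \<subseteq> Poly_Mapping.keys f"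
      by (auto simp: in_keys_iff)
    then show ?thesis using that by (auto simp: TV_def)
  qed
qed (simp add: TV_def)

lemma TV_eq_span:
  fixes B :: "'v set"
  shows "(TV B :: ('v list \<Rightarrow>\<^sub>0 'k::field) set) = pm.span ((\<lambda>w. Poly_Mapping.single w 1) ` lists B)" (is "_ = pm.span ?S")
proof
  show "pm.span ?S \<subseteq> TV B"
    by (rule pm.span_minimal[OF _ subspace_TV]) (auto simp: TV_def split: if_splits)
  show "TV B \<subseteq> pm.span ?S"
  proof
    fix f :: "'v list \<Rightarrow>\<^sub>0 'k" assume "f \<in> TV B"
    then have "lin_ext (\<lambda>w. Poly_Mapping.single w 1) f \<in> pm.span ?S"
      by (intro lin_ext_mem pm.subspace_span pm.span_base) (auto simp: TV_def)
    also have "lin_ext (\<lambda>w. Poly_Mapping.single w 1) f = f"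
      by (rule poly_mapping_eqI)
        (auto simp: lin_ext_def lookup_sum lookup_single when_def in_keys_iff)
    finally show "f \<in> pm.span ?S" .
  qed
qed

text \<open>The letters are homogeneous vectors, which need not belong to the chosen basis. The list
  of degrees is existentially quantified since the letter 0 lies in every component that is a
  subspace, so that a word need not determine its degree.\<close>

definition graded_words :: "(nat \<Rightarrow> 'v set) \<Rightarrow> nat \<Rightarrow> 'v list set"
  where "graded_words Vg n =
    {xs. \<exists>ps. list_all2 (\<lambda>x p. p \<ge> 1 \<and> x \<in> Vg p) xs ps \<and> sum_list ps = n}"

lemma Nil_graded_words: "[] \<in> graded_words Vg 0"
  by (auto simp: graded_words_def)

lemma Cons_graded_words:
  "p \<ge> 1 \<Longrightarrow> x \<in> Vg p \<Longrightarrow> xs \<in> graded_words Vg n \<Longrightarrow> x # xs \<in> graded_words Vg (p + n)"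
  unfolding graded_words_def by (force intro: list_all2_Cons[THEN iffD2])

text \<open>A simultaneous induction on the word and its degree, which hides the lists of degrees
  from the later proofs.\<close>

lemma graded_words_induct [consumes 1, case_names Nil Cons]:
  assumes xs: "xs \<in> graded_words Vg n" and Nil: "Q [] 0"
    and Cons: "\<And>p x xs n. p \<ge> 1 \<Longrightarrow> x \<in> Vg p \<Longrightarrow> xs \<in> graded_words Vg n \<Longrightarrow> Q xs n \<Longrightarrow>
      Q (x # xs) (p + n)"
  shows "Q xs n"
proof -
  obtain ps where ps: "list_all2 (\<lambda>x p. p \<ge> 1 \<and> x \<in> Vg p) xs ps" and n: "n = sum_list ps"
    using xs by (auto simp: graded_words_def)
  from ps have "xs \<in> graded_words Vg (sum_list ps) \<and> Q xs (sum_list ps)"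
    by (induction rule: list_all2_induct)
      (auto simp: Nil intro!: Nil_graded_words Cons_graded_words Cons)
  then show ?thesis using n by simp
qed

lemma T_grade_eq: "T_grade scale B Vg n = pm.span (word scale B ` graded_words Vg n)"
  unfolding T_grade_def graded_words_def by (rule arg_cong[where f = pm.span]) auto

lemma subspace_T_grade: "pm.subspace (T_grade scale B Vg n)"
  by (simp add: T_grade_eq)

text \<open>If \<open>P r\<close> is the projection of \<open>V\<close> onto its component of degree \<open>r\<close>, this is the component
  of degree \<open>n\<close> of a word.\<close>

fun word_component ::
  "('k::field \<Rightarrow> 'v::ab_group_add \<Rightarrow> 'v) \<Rightarrow> 'v set \<Rightarrow> (nat \<Rightarrow> 'v \<Rightarrow> 'v) \<Rightarrow> 'v list \<Rightarrow> nat \<Rightarrow>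
    ('v list \<Rightarrow>\<^sub>0 'k)"
  where
    "word_component scale B P [] n = (if n = 0 then emptyw else 0)"
  | "word_component scale B P (b # w) n =
      (\<Sum>r\<in>{1..n}. cat scale B (P r b) (word_component scale B P w (n - r)))"

section \<open>Homogeneity of the operations on \<open>T(V)\<close> and projections onto its
  components\<close>

context finite_dimensional_vector_space
begin

lemma linear_cat: "Vector_Spaces.linear pm_scale pm_scale (cat scale Basis x)"
  by unfold_locales (simp_all add: cat_add cat_scale)

lemma linear_cat_left: "Vector_Spaces.linear scale pm_scale (\<lambda>x. cat scale Basis x f)"
  by unfold_locales (simp_all add: cat_add_left cat_scale_left)

lemma cat_in_TV: "f \<in> TV Basis \<Longrightarrow> cat scale Basis x f \<in> TV Basis"
  unfolding cat_def
  by (intro pm.subspace_sum subspace_TV lin_ext_mem) (auto simp: TV_def split: if_splits)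

lemma word_in_TV: "word scale Basis xs \<in> TV Basis"
  by (induction xs) (auto simp: word_def cat_in_TV, simp add: TV_def emptyw_def)

lemma T_grade_subset_TV: "T_grade scale Basis Vg n \<subseteq> TV Basis"
  unfolding T_grade_eq by (rule pm.span_minimal[OF _ subspace_TV]) (auto simp: word_in_TV)

lemma emptyw_in_T_grade: "emptyw \<in> T_grade scale Basis Vg 0"
  unfolding T_grade_eq
  by (rule pm.span_base, rule image_eqI[OF _ Nil_graded_words]) (simp add: word_def)

lemma cat_in_T_grade:
  assumes p: "p \<ge> 1" "x \<in> Vg p" and f: "f \<in> T_grade scale Basis Vg n"
  shows "cat scale Basis x f \<in> T_grade scale Basis Vg (p + n)"
proof (rule linear_span_mem[OF linear_cat subspace_T_grade])
  show "f \<in> pm.span (word scale Basis ` graded_words Vg n)"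
    using f by (simp add: T_grade_eq)
  fix w assume "w \<in> word scale Basis ` graded_words Vg n"
  then obtain xs where xs: "xs \<in> graded_words Vg n" "w = word scale Basis xs" by blast
  then have "cat scale Basis x w = word scale Basis (x # xs)"
    by (simp add: word_def)
  then show "cat scale Basis x w \<in> T_grade scale Basis Vg (p + n)"
    using Cons_graded_words[of p x Vg xs n] p xs unfolding T_grade_eq
    by (metis imageI pm.span_base)
qed

text \<open>The recursion \<open>sh_cat_cat\<close> holds for arbitrary letters, so it is available
  on words in homogeneous letters. Both of its terms have the total degree of the two words, and
  bilinearity extends the claim from words to spans.\<close>

lemma sh_in_T_grade:
  assumes f: "f \<in> T_grade scale Basis Vg m" and g: "g \<in> T_grade scale Basis Vg n"
  shows "sh scale Basis f g \<in> T_grade scale Basis Vg (m + n)"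
proof -
  have words: "sh scale Basis (word scale Basis xs) (word scale Basis ys) \<in>
      T_grade scale Basis Vg (m + n)"
    if "xs \<in> graded_words Vg m" "ys \<in> graded_words Vg n" for xs ys
    using that
  proof (induction arbitrary: n ys rule: graded_words_induct)
    case Nil
    then show ?case by (auto simp: word_def sh_emptyw_left T_grade_eq intro: pm.span_base)
  next
    case (Cons p x xs m n ys)
    show ?case
      using Cons.prems
    proof (induction rule: graded_words_induct)
      case Nil
      have "x # xs \<in> graded_words Vg (p + m)"
        by (rule Cons_graded_words) fact+
      then have "word scale Basis (x # xs) \<in> T_grade scale Basis Vg (p + m)"
        unfolding T_grade_eq by (intro pm.span_base imageI)
      then show ?case by (simp add: word_def sh_emptyw_right)
    next
      case inner: (Cons q y ys n)
      let ?X = "word scale Basis xs" and ?Y = "word scale Basis ys"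
      \<comment> \<open>The outer induction hypothesis is used for the whole second word
        \<open>y # ys\<close>, of degree \<open>q + n\<close>; hence \<open>n\<close> and
        \<open>ys\<close> are arbitrary in the outer induction.\<close>
      have "cat scale Basis x (sh scale Basis ?X (word scale Basis (y # ys))) \<in>
          T_grade scale Basis Vg (p + (m + (q + n)))"
        using Cons.hyps inner by (intro cat_in_T_grade Cons.IH Cons_graded_words)
      moreover have "cat scale Basis y (sh scale Basis (word scale Basis (x # xs)) ?Y) \<in>
          T_grade scale Basis Vg (q + (p + m + n))"
        using inner by (intro cat_in_T_grade)
      ultimately show ?case
        by (simp add: word_def sh_cat_cat add_ac pm.subspace_add subspace_T_grade)
    qed
  qed
  have lin: "Vector_Spaces.linear pm_scale pm_scale (sh scale Basis f)"
    "Vector_Spaces.linear pm_scale pm_scale (\<lambda>f. sh scale Basis f g)" for f g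
    by unfold_locales (simp_all add: sh_add sh_scale sh_add_right sh_scale_right)
  have "sh scale Basis (word scale Basis xs) g \<in> T_grade scale Basis Vg (m + n)"
    if "xs \<in> graded_words Vg m" for xs
    by (rule linear_span_mem[OF lin(1) subspace_T_grade _ g[unfolded T_grade_eq]])
      (use words[OF that] in blast)
  then show ?thesis
    by (intro linear_span_mem[OF lin(2) subspace_T_grade _ f[unfolded T_grade_eq]]) blast
qed

text \<open>Taking one index and the constant action \<open>F\<close> in
  \<open>star_single_cat\<close> isolates the inductive rule of \<open>*\<close> from the components
  of \<open>T(V)^N\<close>; the letter may lie outside the basis.\<close>

lemma star_word_cat:
  assumes F: "Vector_Spaces.linear scale scale F"
  defines "S \<equiv> \<lambda>g. lin_ext (\<lambda>w. star_word scale Basis F w g)"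
  shows "S g (cat scale Basis x f) =
    cat scale Basis x (S g f) + cat scale Basis (F x) (sh scale Basis f g)"
proof -
  let ?act = "\<lambda>_. F" and ?e = "Poly_Mapping.single (1::nat)"
  have star: "star 1 scale Basis ?act (?e f) (?e g) = ?e (S g f)" for f
    unfolding S_def by (rule star_single) simp_all
  have "star 1 scale Basis ?act (?e (cat scale Basis x f)) (?e g) =
      ?e (cat scale Basis x (S g f) + cat scale Basis (F x) (sh scale Basis f g))"
    by (rule star_single_cat) (use F star in simp_all)
  then show ?thesis
    unfolding star by (metis lookup_single_eq)
qed

text \<open>When the recursion is unfolded, each resulting term applies \<open>F\<close> to exactly
  one letter and shuffles the letters after it with \<open>g\<close>; hence the degree
  \<open>e\<close> of \<open>F\<close> is added once. The empty word gives 0, which lies in every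
  degree.\<close>

lemma star_word_in_T_grade:
  assumes F: "Vector_Spaces.linear scale scale F"
    and deg: "\<And>p x. p \<ge> 1 \<Longrightarrow> x \<in> Vg p \<Longrightarrow> F x \<in> Vg (p + e)"
    and f: "f \<in> T_grade scale Basis Vg m" and g: "g \<in> T_grade scale Basis Vg n"
  shows "lin_ext (\<lambda>w. star_word scale Basis F w g) f \<in> T_grade scale Basis Vg (m + n + e)"
    (is "?S f \<in> _")
proof -
  have "?S (word scale Basis xs) \<in> T_grade scale Basis Vg (m + n + e)"
    if "xs \<in> graded_words Vg m" for xs
    using that
  proof (induction rule: graded_words_induct)
    case Nil
    show ?case by (simp add: word_def emptyw_def pm.subspace_0 subspace_T_grade)
  next
    case (Cons p x xs m)
    have "cat scale Basis x (?S (word scale Basis xs)) \<in> T_grade scale Basis Vg (p + (m + n + e))"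
      using Cons by (intro cat_in_T_grade)
    moreover have "word scale Basis xs \<in> T_grade scale Basis Vg m"
      using Cons unfolding T_grade_eq by (intro pm.span_base imageI)
    then have "cat scale Basis (F x) (sh scale Basis (word scale Basis xs) g) \<in>
        T_grade scale Basis Vg (p + e + (m + n))"
      using Cons g deg by (intro cat_in_T_grade sh_in_T_grade) auto
    ultimately show ?case
      using star_word_cat[OF F, of g x "word scale Basis xs"]
      by (simp add: word_def add_ac pm.subspace_add subspace_T_grade)
  qed
  then show ?thesis
    by (intro linear_span_mem[OF linear_lin_ext subspace_T_grade _ f[unfolded T_grade_eq]]) blast
qed

text \<open>The recursion of \<open>word_component\<close> runs over basis letters, but both sides
  are linear in \<open>x\<close> and \<open>f\<close>, so it holds for every letter, in particular
  for a homogeneous one outside the basis.\<close>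

lemma word_component_cat:
  assumes P: "\<And>r x y. P r (x + y) = P r x + P r y" "\<And>r c x. P r (scale c x) = scale c (P r x)"
  defines "\<pi> \<equiv> \<lambda>n. lin_ext (\<lambda>w. word_component scale Basis P w n)"
  shows "\<pi> n (cat scale Basis x f) = (\<Sum>r\<in>{1..n}. cat scale Basis (P r x) (\<pi> (n - r) f))"
proof -
  let ?L = "\<lambda>x f. \<pi> n (cat scale Basis x f)"
  let ?R = "\<lambda>x f. \<Sum>r\<in>{1..n}. cat scale Basis (P r x) (\<pi> (n - r) f)"
  note lin = P lin_ext_add lin_ext_scale cat_add cat_scale cat_add_left cat_scale_left
    pm_scale_add pm_scale_sum sum.distrib
  have "?L b f = ?R b f" if "b \<in> Basis" for b
    unfolding \<pi>_def
    by (rule lin_ext_eqI[of "\<lambda>f. lin_ext (\<lambda>w. word_component scale Basis P w n) (cat scale Basis b f)"])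
      (simp_all add: lin cat_Basis_single that)
  note Basis = this
  show ?thesis
    by (rule bilinear_cat_eqI[of "\<lambda>x. ?L x f" "\<lambda>x. ?R x f"], goal_cases)
      (simp_all only: Basis, simp_all add: lin \<pi>_def)
qed

text \<open>For spanning, each basis letter is expanded into homogeneous vectors. For independence,
  \<open>\<pi> j\<close> isolates the term of degree \<open>j\<close> in a relation.\<close>

lemma direct_sum_T_grade:
  assumes V: "direct_sum scale {1..} Vg UNIV"
  shows "direct_sum pm_scale UNIV (T_grade scale Basis Vg) (TV Basis)"
proof (rule pm.direct_sumI)
  let ?G = "\<Union>n. T_grade scale Basis Vg n"
  \<comment> \<open>Linearity in the letter reduces to a homogeneous \<open>y\<close>, linearity in
    \<open>f\<close> to a homogeneous element, and there \<open>cat_in_T_grade\<close>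
    applies.\<close>
  have cat_span: "cat scale Basis x f \<in> pm.span ?G" if f: "f \<in> pm.span ?G" for x f
  proof (rule linear_span_mem[OF linear_cat_left pm.subspace_span])
    show "x \<in> span (\<Union>p\<in>{1..}. Vg p)"
      using direct_sum_subset_span[OF V] by blast
    fix y assume "y \<in> (\<Union>p\<in>{1..}. Vg p)"
    then obtain p where p: "p \<ge> 1" "y \<in> Vg p" by auto
    show "cat scale Basis y f \<in> pm.span ?G"
    proof (rule linear_span_mem[OF linear_cat pm.subspace_span _ f])
      show "cat scale Basis y h \<in> pm.span ?G" if "h \<in> ?G" for h
        using that cat_in_T_grade[where Vg = Vg, OF p] by (blast intro: pm.span_base)
    qed
  qed
  have "Poly_Mapping.single w 1 \<in> pm.span ?G" if "w \<in> lists Basis" for w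
    using that
  proof (induction w)
    case Nil
    show ?case
      using emptyw_in_T_grade by (intro pm.span_base) (auto simp: emptyw_def)
  next
    case (Cons b w)
    then show ?case using cat_span[of _ b] by (metis cat_Basis_single)
  qed
  then show "TV Basis \<subseteq> pm.span ?G"
    unfolding TV_eq_span by (intro pm.span_minimal) auto
next
  fix J :: "nat set" and x j
  assume J: "finite J" and x: "\<And>i. i \<in> J \<Longrightarrow> x i \<in> T_grade scale Basis Vg i"
    and 0: "sum x J = 0" and j: "j \<in> J"
  from direct_sum_projections[OF V] obtain P where
    P: "\<And>r x y. P r (x + y) = P r x + P r y" "\<And>r c x. P r (scale c x) = scale c (P r x)"
    and P_hom: "\<forall>r\<in>{1..}. \<forall>x\<in>Vg r. \<forall>s. P s x = (if r = s then x else 0)"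
    by (elim exE conjE) blast
  define \<pi> where "\<pi> n = lin_ext (\<lambda>w. word_component scale Basis P w n)" for n
  have words: "\<pi> k (word scale Basis xs) = (if k = n then word scale Basis xs else 0)"
    if "xs \<in> graded_words Vg n" for xs n k
    using that
  proof (induction arbitrary: k rule: graded_words_induct)
    case Nil
    show ?case by (simp add: word_def \<pi>_def emptyw_def)
  next
    case (Cons p x xs n)
    have "\<pi> k (word scale Basis (x # xs)) =
        (\<Sum>r\<in>{1..k}. cat scale Basis (P r x) (\<pi> (k - r) (word scale Basis xs)))"
      using word_component_cat[where P = P, OF P] by (simp add: \<pi>_def word_def)
    \<comment> \<open>The projection \<open>P r\<close> kills \<open>x\<close> unless
      \<open>r = p\<close>. If \<open>p > k\<close>, no term survives, in agreement with
      \<open>k \<noteq> p + n\<close>.\<close>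
    also have "\<dots> = (\<Sum>r\<in>{1..k}. if r = p then cat scale Basis x (\<pi> (k - p) (word scale Basis xs)) else 0)"
      using Cons.hyps P_hom by (intro sum.cong) auto
    also have "\<dots> = (if k = p + n then word scale Basis (x # xs) else 0)"
      using Cons by (auto simp: word_def)
    finally show ?case .
  qed
  have hom: "\<pi> k f = (if k = n then f else 0)" if "f \<in> T_grade scale Basis Vg n" for f n k
    using that unfolding T_grade_eq
    by (induction rule: pm.span_induct)
      (auto simp: words[unfolded \<pi>_def] \<pi>_def lin_ext_add lin_ext_scale intro!: pm.subspaceI split: if_splits)
  have "0 = \<pi> j (sum x J)"
    by (simp add: 0 \<pi>_def)
  also have "\<dots> = (\<Sum>i\<in>J. \<pi> j (x i))"
    by (simp add: \<pi>_def lin_ext_sum)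
  also have "\<dots> = (\<Sum>i\<in>J. if i = j then x j else 0)"
    using hom[OF x] by (intro sum.cong refl) auto
  finally show "x j = 0"
    using J j by simp
qed (auto simp: subspace_TV subspace_T_grade T_grade_subset_TV[THEN subsetD])

end

section \<open>The grading of \<open>V\<close>\<close>

context vector_space
begin

lemma subspace_V_weight:
  assumes "\<And>U. U \<in> \<U> \<Longrightarrow> subspace (D U p)"
  shows "subspace (V_weight \<U> D p)"
proof (rule subspaceI)
  show "0 \<in> V_weight \<U> D p"
    using assms subspace_0 by (auto simp: V_weight_def intro!: exI[of _ "\<lambda>_. 0"])
  fix x y c assume x: "x \<in> V_weight \<U> D p"
  then obtain x' where x': "x = sum x' \<U>" "\<And>U. U \<in> \<U> \<Longrightarrow> x' U \<in> D U p"
    by (auto simp: V_weight_def)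
  show "scale c x \<in> V_weight \<U> D p"
    using x' assms subspace_scale
    by (auto simp: V_weight_def scale_sum_right intro!: exI[of _ "\<lambda>U. scale c (x' U)"])
  assume "y \<in> V_weight \<U> D p"
  then obtain y' where y': "y = sum y' \<U>" "\<And>U. U \<in> \<U> \<Longrightarrow> y' U \<in> D U p"
    by (auto simp: V_weight_def)
  show "x + y \<in> V_weight \<U> D p"
    using x' y' assms subspace_add
    by (auto simp: V_weight_def sum.distrib intro!: exI[of _ "\<lambda>U. x' U + y' U"])
qed

lemma subset_V_weight:
  assumes "finite \<U>" "U \<in> \<U>" "\<And>U. U \<in> \<U> \<Longrightarrow> subspace (D U p)"
  shows "D U p \<subseteq> V_weight \<U> D p"
proof
  fix x assume "x \<in> D U p"
  then show "x \<in> V_weight \<U> D p"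
    using assms subspace_0
    by (auto simp: V_weight_def intro!: exI[of _ "\<lambda>U'. if U' = U then x else 0"])
qed

lemma V_weight_image:
  assumes F: "Vector_Spaces.linear scale scale F"
    and D: "\<And>U x. U \<in> \<U> \<Longrightarrow> x \<in> D U p \<Longrightarrow> F x \<in> D U q" and x: "x \<in> V_weight \<U> D p"
  shows "F x \<in> V_weight \<U> D q"
proof -
  interpret F: Vector_Spaces.linear scale scale F by (rule F)
  obtain x' where "x = sum x' \<U>" "\<And>U. U \<in> \<U> \<Longrightarrow> x' U \<in> D U p"
    using x by (auto simp: V_weight_def)
  then show ?thesis
    using D by (auto simp: V_weight_def F.sum intro!: exI[of _ "\<lambda>U. F (x' U)"])
qed

text \<open>The pieces \<open>D U p\<close> are regrouped by degree. A relation between components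
  is first split along the direct sum of the \<open>U\<close>; inside one \<open>U\<close> it
  becomes a relation between pieces of distinct weights.\<close>

lemma direct_sum_V_grade:
  assumes fin: "finite \<U>" and \<U>: "direct_sum scale \<U> (\<lambda>U. U) UNIV"
    and D: "\<And>U. U \<in> \<U> \<Longrightarrow> direct_sum scale {0..kk U} (D U) U"
    and D0: "\<And>U p. U \<in> \<U> \<Longrightarrow> p > kk U \<Longrightarrow> D U p = {0}"
  shows "direct_sum scale {1..} (V_grade \<U> kk D) UNIV"
proof (rule direct_sumI)
  define K where "K = top_weight \<U> kk"
  have kk: "kk U \<le> K" if "U \<in> \<U>" for U
    using that fin by (simp add: K_def top_weight_def)
  have subD: "subspace (D U p)" if "U \<in> \<U>" for U p
    using direct_sum_subspace[OF D[OF that], of p] D0[OF that, of p] subspace_single_0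
    by (cases "p \<le> kk U") auto
  have DU: "D U p \<subseteq> U" if "U \<in> \<U>" for U p
  proof (cases "p \<le> kk U")
    case True
    then show ?thesis using D[OF that] by (auto simp: direct_sum_def)
  next
    case False
    then show ?thesis using D0[OF that, of p] direct_sum_subspace[OF \<U> that] subspace_0 by auto
  qed
  note grade = V_grade_def[of \<U> kk D, folded K_def]
  show "subspace (V_grade \<U> kk D r)" for r
    by (auto simp: grade intro!: subspace_V_weight subD subspace_single_0)
  \<comment> \<open>The piece of weight \<open>p\<close> has degree \<open>K + 1 - p\<close>. A
    weight above \<open>K\<close> exceeds every \<open>kk U\<close>, so its piece is zero.\<close>
  have "x \<in> span (\<Union>r\<in>{1..}. V_grade \<U> kk D r)" if U: "U \<in> \<U>" and x: "x \<in> D U p" for U p x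
  proof (cases "p \<le> K")
    case True
    then have "x \<in> V_grade \<U> kk D (K + 1 - p)"
      using x subset_V_weight[of \<U> U D p] fin U subD by (auto simp: grade)
    then show ?thesis
      using True by (intro span_base UN_I[of "K + 1 - p"]) auto
  next
    case False
    then show ?thesis using x D0[OF U, of p] kk[OF U] by (auto simp: span_zero)
  qed
  then have "span (\<Union>p\<in>{0..kk U}. D U p) \<subseteq> span (\<Union>r\<in>{1..}. V_grade \<U> kk D r)" if "U \<in> \<U>" for U
    using that by (intro span_minimal subspace_span) blast
  then have "U \<subseteq> span (\<Union>r\<in>{1..}. V_grade \<U> kk D r)" if "U \<in> \<U>" for U
    using that direct_sum_subset_span[OF D[OF that]] by blast
  then have "span (\<Union>U\<in>\<U>. U) \<subseteq> span (\<Union>r\<in>{1..}. V_grade \<U> kk D r)"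
    by (intro span_minimal subspace_span) blast
  then show "UNIV \<subseteq> span (\<Union>r\<in>{1..}. V_grade \<U> kk D r)"
    using direct_sum_subset_span[OF \<U>] by (rule order_trans[rotated])
  fix J :: "nat set" and x j
  assume J: "finite J" "J \<subseteq> {1..}" and x: "\<And>r. r \<in> J \<Longrightarrow> x r \<in> V_grade \<U> kk D r"
    and sum0: "sum x J = 0" and j: "j \<in> J"
  \<comment> \<open>The guard \<open>r \<le> K + 1\<close> matters: beyond it truncated subtraction
    would return weight 0, although the component of degree \<open>r\<close> is zero.\<close>
  have "\<forall>r\<in>J. \<exists>y. x r = sum y \<U> \<and> (\<forall>U\<in>\<U>. y U \<in> (if r \<le> K + 1 then D U (K + 1 - r) else {0}))"
  proof
    fix r assume r: "r \<in> J"
    show "\<exists>y. x r = sum y \<U> \<and> (\<forall>U\<in>\<U>. y U \<in> (if r \<le> K + 1 then D U (K + 1 - r) else {0}))"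
    proof (cases "r \<le> K + 1")
      case True
      then show ?thesis
        using x[OF r] J r by (auto simp: grade V_weight_def)
    next
      case False
      then show ?thesis
        using x[OF r] by (intro exI[of _ "\<lambda>_. 0"]) (auto simp: grade)
    qed
  qed
  then obtain y where y: "\<forall>r\<in>J. x r = sum (y r) \<U> \<and>
      (\<forall>U\<in>\<U>. y r U \<in> (if r \<le> K + 1 then D U (K + 1 - r) else {0}))"
    by (elim bchoice[THEN exE])
  have yU: "y r U \<in> U" if "r \<in> J" "U \<in> \<U>" for r U
    using y that DU[OF that(2)] direct_sum_subspace[OF \<U> that(2)] subspace_0
    by (fastforce split: if_splits)
  \<comment> \<open>Summed over \<open>U\<close>, these vectors give the relation
    \<open>sum x J = 0\<close>, and the sum of the \<open>U\<close> is direct.\<close>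
  have ysum: "(\<Sum>r\<in>J. y r U) = 0" if "U \<in> \<U>" for U
  proof (rule direct_sum_indep[OF \<U> fin, where \<sigma> = "\<lambda>U. U"])
    have "(\<Sum>U\<in>\<U>. \<Sum>r\<in>J. y r U) = (\<Sum>r\<in>J. sum (y r) \<U>)"
      by (rule sum.swap)
    also have "\<dots> = sum x J"
      using y by (intro sum.cong) auto
    finally show "(\<Sum>U\<in>\<U>. \<Sum>r\<in>J. y r U) = 0"
      using sum0 by simp
    show "(\<Sum>r\<in>J. y r U) \<in> U" if "U \<in> \<U>" for U
      using that by (intro subspace_sum yU direct_sum_subspace[OF \<U>])
  qed (use that in auto)
  have "y j U = 0" if U: "U \<in> \<U>" for U
  proof -
    \<comment> \<open>The set \<open>L\<close> consists of the degrees in \<open>J\<close> whose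
      weight lies in \<open>{0..kk U}\<close>; the other terms vanish. On \<open>L\<close> no
      subtraction is truncated, so distinct degrees have distinct weights.\<close>
    define L where "L = {r \<in> J. r \<le> K + 1 \<and> K + 1 - r \<le> kk U}"
    have out: "y r U = 0" if "r \<in> J - L" for r
      using that y U D0[OF U, of "K + 1 - r"] by (fastforce simp: L_def split: if_splits)
    have "(\<Sum>r\<in>J. y r U) = (\<Sum>r\<in>L. y r U)"
      using J out by (intro sum.mono_neutral_right) (auto simp: L_def)
    then have 0: "(\<Sum>r\<in>L. y r U) = 0"
      using ysum[OF U] by simp
    show ?thesis
    proof (cases "j \<in> L")
      case True
      show ?thesis
      proof (rule direct_sum_indep[OF D[OF U], of L "\<lambda>r. K + 1 - r"])
        show "inj_on (\<lambda>r. K + 1 - r) L"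
          by (auto simp: inj_on_def L_def)
        show "y r U \<in> D U (K + 1 - r)" if "r \<in> L" for r
          using that y U by (auto simp: L_def)
      qed (use J True 0 in \<open>auto simp: L_def\<close>)
    qed (use out j in auto)
  qed
  then show "x j = 0"
    using y j by simp
qed auto

section \<open>Action of the \<open>\<epsilon>\<^sub>i\<close> on the grading of
  \<open>V\<close>\<close>

lemma V_grade_image:
  assumes F: "Vector_Spaces.linear scale scale F" and D: "\<And>U p x. U \<in> \<U> \<Longrightarrow> x \<in> D U p \<Longrightarrow> F x \<in> D U p"
    and x: "x \<in> V_grade \<U> kk D r"
  shows "F x \<in> V_grade \<U> kk D r"
  using x V_weight_image[OF F D] linear_imp_zero[OF F] by (auto simp: V_grade_def split: if_splits)

text \<open>With \<open>K\<close> the top weight, degree \<open>r\<close> is weight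
  \<open>K + 1 - r\<close>, so lowering the weight by one raises the degree by one. In the top
  degree \<open>K + 1\<close> the weight is 0 and \<open>F\<close> vanishes; beyond it the component
  is zero.\<close>

lemma V_grade_image_lowering:
  assumes F: "Vector_Spaces.linear scale scale F"
    and D: "\<And>U p x. U \<in> \<U> \<Longrightarrow> x \<in> D U p \<Longrightarrow> F x \<in> (if p = 0 then {0} else D U (p - 1))"
    and r: "r \<ge> 1" and x: "x \<in> V_grade \<U> kk D r"
  shows "F x \<in> V_grade \<U> kk D (r + 1)"
proof -
  interpret F: Vector_Spaces.linear scale scale F by (rule F)
  define K where "K = top_weight \<U> kk"
  note grade = V_grade_def[of \<U> kk D, folded K_def]
  consider "r \<le> K" | "r = K + 1" | "r > K + 1" by linarith
  then show ?thesis
  proof cases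
    case 1
    then have "x \<in> V_weight \<U> D (K + 1 - r)"
      using x r by (simp add: grade)
    then have "F x \<in> V_weight \<U> D (K - r)"
    proof (rule V_weight_image[OF F, rotated])
      show "F y \<in> D U (K - r)" if "U \<in> \<U>" "y \<in> D U (K + 1 - r)" for U y
        using D[OF that] 1 by (simp split: if_splits)
    qed
    then show ?thesis using 1 by (simp add: grade)
  next
    case 2
    then obtain y where y: "x = sum y \<U>" "\<And>U. U \<in> \<U> \<Longrightarrow> y U \<in> D U 0"
      using x by (auto simp: grade V_weight_def)
    then have "F x = 0"
      using D[of _ _ 0] by (simp add: F.sum)
    then show ?thesis using 2 by (simp add: grade)
  next
    case 3
    then show ?thesis using x by (simp add: grade F.zero)
  qed
qed

end

section \<open>The grading of the post-Lie algebra\<close>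

text \<open>Treats the unshifted first component and the shifted others uniformly, so that
  homogeneity can be checked one index at a time; \<open>{0}\<close> stands for \<open>T(V)\<close>
  in degree -1.\<close>

definition T_shift ::
  "('k::field \<Rightarrow> 'v::ab_group_add \<Rightarrow> 'v) \<Rightarrow> 'v set \<Rightarrow> (nat \<Rightarrow> 'v set) \<Rightarrow> nat \<Rightarrow> nat \<Rightarrow>
    ('v list \<Rightarrow>\<^sub>0 'k) set"
  where "T_shift scale B Vg i n =
    (if i = 1 then T_grade scale B Vg n else if n = 0 then {0} else T_grade scale B Vg (n - 1))"

lemma subspace_T_shift: "pm.subspace (T_shift scale B Vg i n)"
  by (simp add: T_shift_def subspace_T_grade pm.subspace_single_0)

lemma g_grade_iff:
  assumes "N \<ge> 1"
  shows "u \<in> g_grade N scale B Vg n \<longleftrightarrow>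
    u \<in> TVN N B \<and> (\<forall>i\<in>{1..N}. Poly_Mapping.lookup u i \<in> T_shift scale B Vg i n)"
proof -
  have "{1..N} = insert 1 {2..N}" using assms by auto
  then show ?thesis by (auto simp: g_grade_def T_shift_def)
qed

lemma linear_single: "Vector_Spaces.linear pm_scale pm_scale2 (Poly_Mapping.single i)"
  by unfold_locales
    (auto intro!: poly_mapping_eqI simp: lookup_add lookup_single when_def algebra_simps
      pm_scale_add pm_scale_add_left)

lemma subspace_TVN:
  fixes B :: "'v set"
  shows "pm2.subspace (TVN N B :: (nat \<Rightarrow>\<^sub>0 ('v list \<Rightarrow>\<^sub>0 'k::field)) set)"
proof (rule pm2.subspaceI)
  fix u v :: "nat \<Rightarrow>\<^sub>0 ('v list \<Rightarrow>\<^sub>0 'k)" and c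
  show "u + v \<in> TVN N B" if "u \<in> TVN N B" "v \<in> TVN N B"
    using that keys_add[of u v] by (auto simp: TVN_def lookup_add pm.subspace_add subspace_TV)
  show "pm_scale2 c u \<in> TVN N B" if "u \<in> TVN N B"
  proof -
    have "Poly_Mapping.keys (pm_scale2 c u) \<subseteq> Poly_Mapping.keys u"
      by (auto simp: in_keys_iff)
    then show ?thesis using that by (auto simp: TVN_def pm.subspace_scale subspace_TV)
  qed
qed (simp add: TVN_def pm.subspace_0 subspace_TV)

lemma subspace_g_grade:
  assumes "N \<ge> 1"
  shows "pm2.subspace (g_grade N scale B Vg n)"
  by (rule pm2.subspaceI)
    (simp_all add: g_grade_iff[OF assms] subspace_TVN pm2.subspace_0 pm2.subspace_add
      pm2.subspace_scale lookup_add subspace_T_shift pm.subspace_0 pm.subspace_add pm.subspace_scale)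

context finite_dimensional_vector_space
begin

text \<open>The operations are defined as sums of elements concentrated in a single index, up to
  sign, so membership comes down to one component.\<close>

lemma single_in_g_grade:
  assumes N: "i \<in> {1..N}" and f: "f \<in> T_shift scale Basis Vg i n"
  shows "Poly_Mapping.single i f \<in> g_grade N scale Basis Vg n"
proof -
  have "f \<in> TV Basis"
    using f T_grade_subset_TV pm.subspace_0[OF subspace_TV]
    by (auto simp: T_shift_def split: if_splits)
  then show ?thesis
    using assms by (auto simp: g_grade_iff TVN_def lookup_single when_def pm.subspace_0 subspace_TV
      subspace_T_shift split: if_splits)
qed

text \<open>The argument runs component by component: the first carries the grading of
  \<open>T(V)\<close>, the others its shift by one.\<close>

lemma direct_sum_g_grade:
  assumes N: "N \<ge> 1" and T: "direct_sum pm_scale UNIV (T_grade scale Basis Vg) (TV Basis)"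
  shows "direct_sum pm_scale2 UNIV (g_grade N scale Basis Vg) (TVN N Basis)"
proof (rule pm2.direct_sumI)
  let ?G = "\<Union>n. g_grade N scale Basis Vg n"
  show "TVN N Basis \<subseteq> pm2.span ?G"
  proof
    fix u :: "nat \<Rightarrow>\<^sub>0 ('b list \<Rightarrow>\<^sub>0 'a)" assume u: "u \<in> TVN N Basis"
    have "Poly_Mapping.single i (Poly_Mapping.lookup u i) \<in> pm2.span ?G" if i: "i \<in> {1..N}" for i
    proof (rule linear_span_mem[OF linear_single pm2.subspace_span])
      show "Poly_Mapping.lookup u i \<in> pm.span (\<Union>n. T_grade scale Basis Vg n)"
        using pm.direct_sum_subset_span[OF T] u by (auto simp: TVN_def)
      fix f assume "f \<in> (\<Union>n. T_grade scale Basis Vg n)"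
      then obtain n where "f \<in> T_grade scale Basis Vg n" by blast
      \<comment> \<open>In a component other than the first, degree \<open>n\<close> of
        \<open>T(V)\<close> counts as degree \<open>n + 1\<close>.\<close>
      then have "f \<in> T_shift scale Basis Vg i (if i = 1 then n else n + 1)"
        by (simp add: T_shift_def)
      then show "Poly_Mapping.single i f \<in> pm2.span ?G"
        using single_in_g_grade[OF i] by (blast intro: pm2.span_base)
    qed
    then have "(\<Sum>i\<in>{1..N}. Poly_Mapping.single i (Poly_Mapping.lookup u i)) \<in> pm2.span ?G"
      by (rule pm2.span_sum)
    also have "(\<Sum>i\<in>{1..N}. Poly_Mapping.single i (Poly_Mapping.lookup u i)) = u"
    proof (rule poly_mapping_eqI)
      show "Poly_Mapping.lookup (\<Sum>i\<in>{1..N}. Poly_Mapping.single i (Poly_Mapping.lookup u i)) k =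
          Poly_Mapping.lookup u k" for k
        using u by (cases "k \<in> {1..N}")
          (auto simp: lookup_sum lookup_single when_def TVN_def in_keys_iff subset_iff)
    qed
    finally show "u \<in> pm2.span ?G" .
  qed
next
  fix J :: "nat set" and x j
  assume J: "finite J" and x: "\<And>n. n \<in> J \<Longrightarrow> x n \<in> g_grade N scale Basis Vg n"
    and 0: "sum x J = 0" and j: "j \<in> J"
  have sum0: "(\<Sum>n\<in>J. Poly_Mapping.lookup (x n) i) = 0" for i
    using 0 by (metis lookup_sum lookup_zero)
  have shift: "Poly_Mapping.lookup (x n) i \<in> T_shift scale Basis Vg i n"
    if "n \<in> J" "i \<in> {1..N}" for n i
    using x[OF that(1)] that(2) N by (simp add: g_grade_iff)
  show "x j = 0"
  proof (rule poly_mapping_eqI)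
    fix i
    consider "i = 1" | "i \<in> {1..N}" "i \<noteq> 1" | "i \<notin> {1..N}" by blast
    then show "Poly_Mapping.lookup (x j) i = Poly_Mapping.lookup 0 i"
    proof cases
      case 1
      have "Poly_Mapping.lookup (x j) i = 0"
        by (rule pm.direct_sum_indep[OF T J, where \<sigma> = "\<lambda>n. n"])
          (use sum0 shift[of _ 1] 1 j N in \<open>auto simp: T_shift_def\<close>)
      then show ?thesis by simp
    next
      case 2
      \<comment> \<open>Degree 0 contributes nothing here and is removed first, since truncated
        \<open>n - 1\<close> is injective only on positive \<open>n\<close>: it sends both 0 and 1
        to 0.\<close>
      have zero: "Poly_Mapping.lookup (x 0) i = 0" if "0 \<in> J"
        using shift[OF that 2(1)] 2 by (simp add: T_shift_def)
      show ?thesis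
      proof (cases "j = 0")
        case False
        have mem: "Poly_Mapping.lookup (x n) i \<in> T_grade scale Basis Vg (n - 1)" if "n \<in> J - {0}" for n
          using shift[of n i] that 2 by (simp add: T_shift_def)
        have "(\<Sum>n\<in>J - {0}. Poly_Mapping.lookup (x n) i) = 0"
          using sum0[of i] zero J by (cases "0 \<in> J") (auto simp: sum_diff1)
        then have "Poly_Mapping.lookup (x j) i = 0"
          by (intro pm.direct_sum_indep[OF T, of "J - {0}" "\<lambda>n. n - 1" "\<lambda>n. Poly_Mapping.lookup (x n) i" j])
            (use J j False mem in \<open>auto simp: inj_on_def\<close>)
        then show ?thesis by simp
      qed (use zero j in simp)
    next
      case 3
      then show ?thesis
        using x[OF j] by (auto simp: g_grade_def TVN_def in_keys_iff subset_iff)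
    qed
  qed
qed (auto simp: subspace_TVN subspace_g_grade[OF N] g_grade_iff[OF N])

section \<open>Homogeneity of the bracket and of \<open>*\<close>\<close>

lemma sh_0 [simp]: "sh scale Basis 0 g = 0" "sh scale Basis f 0 = 0"
  using sh_scale[of 0 0 g] sh_scale_right[of f 0 0] by simp_all

text \<open>The two terms cancel for \<open>i = j = 1\<close>, and both coefficients vanish when
  neither index is 1, so that only the mixed pairs contribute.\<close>

lemma bracket_in_g_grade:
  assumes N: "N \<ge> 1"
    and u: "u \<in> g_grade N scale Basis Vg m" and v: "v \<in> g_grade N scale Basis Vg n"
  shows "bracket N (eps 1) scale Basis u v \<in> g_grade N scale Basis Vg (m + n)"
  unfolding bracket_def Let_def
proof (intro pm2.subspace_sum subspace_g_grade N)
  fix i j assume i: "i \<in> {1..N}" and j: "j \<in> {1..N}"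
  let ?s = "sh scale Basis (Poly_Mapping.lookup u i) (Poly_Mapping.lookup v j)"
  have ui: "Poly_Mapping.lookup u i \<in> T_shift scale Basis Vg i m"
    and vj: "Poly_Mapping.lookup v j \<in> T_shift scale Basis Vg j n"
    using u v i j N by (simp_all add: g_grade_iff)
  have "Poly_Mapping.single j ?s \<in> g_grade N scale Basis Vg (m + n)" if "i = 1" "j \<noteq> 1"
  proof (rule single_in_g_grade[OF j])
    \<comment> \<open>For \<open>n = 0\<close> the factor from \<open>v\<close> is 0; otherwise the
      shuffle has degree \<open>m + (n - 1)\<close>, which is what component \<open>j\<close>
      requires in degree \<open>m + n\<close>.\<close>
    show "?s \<in> T_shift scale Basis Vg j (m + n)"
      using ui vj that sh_in_T_grade[of _ Vg m _ "n - 1"]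
      by (cases "n = 0") (auto simp: T_shift_def pm.subspace_0 subspace_T_grade)
  qed
  moreover have "Poly_Mapping.single i ?s \<in> g_grade N scale Basis Vg (m + n)" if "i \<noteq> 1" "j = 1"
  proof (rule single_in_g_grade[OF i])
    show "?s \<in> T_shift scale Basis Vg i (m + n)"
      using ui vj that sh_in_T_grade[of _ Vg "m - 1" _ n]
      by (cases "m = 0") (auto simp: T_shift_def pm.subspace_0 subspace_T_grade)
  qed
  moreover have "0 \<in> g_grade N scale Basis Vg (m + n)"
    by (intro pm2.subspace_0 subspace_g_grade N)
  ultimately show "Poly_Mapping.single j (pm_scale (Poly_Mapping.lookup (eps 1) i) ?s) -
      Poly_Mapping.single i (pm_scale (Poly_Mapping.lookup (eps 1) j) ?s) \<in>
      g_grade N scale Basis Vg (m + n)"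
    using pm2.subspace_neg[OF subspace_g_grade[OF N]]
    by (cases "i = 1"; cases "j = 1") (auto simp: eps_def lookup_single)
qed

text \<open>For \<open>j \<ge> 2\<close> the component \<open>j\<close> of \<open>v\<close> has
  degree \<open>n - 1\<close>, and the degree 1 of \<open>act (eps j)\<close> makes up for the
  missing one. For \<open>j = 1\<close> both corrections are absent. The index \<open>i\<close>,
  hence its shift, is inherited from \<open>u\<close>.\<close>

lemma star_in_g_grade:
  assumes N: "N \<ge> 1"
    and lin: "\<And>j. j \<in> {1..N} \<Longrightarrow> Vector_Spaces.linear scale scale (act (eps j))"
    and deg: "\<And>p x. p \<ge> 1 \<Longrightarrow> x \<in> Vg p \<Longrightarrow> act (eps 1) x \<in> Vg p"
      "\<And>j p x. j \<in> {2..N} \<Longrightarrow> p \<ge> 1 \<Longrightarrow> x \<in> Vg p \<Longrightarrow> act (eps j) x \<in> Vg (p + 1)"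
    and u: "u \<in> g_grade N scale Basis Vg m" and v: "v \<in> g_grade N scale Basis Vg n"
  shows "star N scale Basis act u v \<in> g_grade N scale Basis Vg (m + n)"
  unfolding star_def
proof (intro pm2.subspace_sum subspace_g_grade N single_in_g_grade)
  fix i j assume i: "i \<in> {1..N}" and j: "j \<in> {1..N}"
  let ?S = "\<lambda>g. lin_ext (\<lambda>w. star_word scale Basis (act (eps j)) w g)"
  have ui: "Poly_Mapping.lookup u i \<in> T_shift scale Basis Vg i m"
    and vj: "Poly_Mapping.lookup v j \<in> T_shift scale Basis Vg j n"
    using u v i j N by (simp_all add: g_grade_iff)
  have S: "?S (Poly_Mapping.lookup v j) f \<in> T_grade scale Basis Vg (k + n)"
    if f: "f \<in> T_grade scale Basis Vg k" for f k
  proof -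
    consider "j = 1" | "j \<noteq> 1" "n = 0" | "j \<noteq> 1" "n \<noteq> 0" by blast
    then show ?thesis
    proof cases
      case 1
      then show ?thesis
        using star_word_in_T_grade[OF lin[OF j], of Vg 0 f k "Poly_Mapping.lookup v j" n] deg(1) f vj
        by (simp add: T_shift_def)
    next
      case 2
      have "star_word scale Basis F w 0 = 0" for F w
        by (induction w) simp_all
      then show ?thesis
        using 2 vj by (simp add: T_shift_def lin_ext_def pm.subspace_0 subspace_T_grade)
    next
      case 3
      then have "j \<in> {2..N}" using j by auto
      then show ?thesis
        using star_word_in_T_grade[OF lin[OF j], of Vg 1 f k "Poly_Mapping.lookup v j" "n - 1"]
          deg(2)[of j] f vj 3
        by (simp add: T_shift_def)
    qed
  qed
  \<comment> \<open>Here \<open>k\<close> is \<open>m\<close> for \<open>i = 1\<close> and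
    \<open>m - 1\<close> otherwise; when \<open>m = 0\<close>, the components of \<open>u\<close>
    with \<open>i \<noteq> 1\<close> are 0.\<close>
  show "?S (Poly_Mapping.lookup v j) (Poly_Mapping.lookup u i) \<in> T_shift scale Basis Vg i (m + n)"
    using ui S[of _ m] S[of _ "m - 1"]
    by (cases "m = 0") (auto simp: T_shift_def pm.subspace_0 subspace_T_grade split: if_splits)
qed

end

text \<open>The summands and their decompositions enter as arbitrary data, so the grading property
  holds for every choice of them. The basis \<open>B\<close> fixes the words spanning
  \<open>T(V)\<close> and may consist of non-homogeneous vectors.\<close>

theorem proposition18:
  fixes N :: nat
    and a :: "nat \<Rightarrow>\<^sub>0 'k::alg_closed_field"
    and scale :: "'k \<Rightarrow> 'v::ab_group_add \<Rightarrow> 'v"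
    and B :: "'v set"
    and act :: "(nat \<Rightarrow>\<^sub>0 'k) \<Rightarrow> 'v \<Rightarrow> 'v"
    and \<U> :: "'v set set"
    and lam :: "'v set \<Rightarrow> 'k"
    and kk :: "'v set \<Rightarrow> nat"
    and D :: "'v set \<Rightarrow> nat \<Rightarrow> 'v set"
  assumes N: "N \<ge> 1"
    and a: "a = eps 1"
    and V: "finite_dimensional_vector_space scale B"
    and act: "ga_module N a scale act"
    and summands: "finite \<U>" "direct_sum scale \<U> (\<lambda>U. U) UNIV"
      "\<forall>U\<in>\<U>. indecomposable N scale act U"
    and weights: "\<forall>U\<in>\<U>. weight_decomposition N scale act U (lam U) (kk U) (D U)"
  shows "let gr = g_grade N scale B (V_grade \<U> kk D) in
    direct_sum pm_scale2 UNIV gr (TVN N B) \<and>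
    (\<forall>m n. \<forall>u\<in>gr m. \<forall>v\<in>gr n.
      bracket N a scale B u v \<in> gr (m + n) \<and> star N scale B act u v \<in> gr (m + n))"
proof -
  interpret V: finite_dimensional_vector_space scale B by (rule V)
  let ?Vg = "V_grade \<U> kk D"
  have lin: "Vector_Spaces.linear scale scale (act (eps j))" if "j \<in> {1..N}" for j
    using act that by (auto simp: ga_module_def KN_def eps_def)
  have D: "direct_sum scale {0..kk U} (D U) U" and D0: "\<And>p. p > kk U \<Longrightarrow> D U p = {0}"
    if "U \<in> \<U>" for U
    using weights that by (auto simp: weight_decomposition_def)
  have DU0: "0 \<in> D U p" if "U \<in> \<U>" for U p
    using V.direct_sum_subspace[OF D[OF that], of p] D0[OF that, of p] V.subspace_0
    by (cases "p \<le> kk U") auto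
  \<comment> \<open>The weight conditions concern \<open>p \<le> kk U\<close>; beyond,
    \<open>D U p\<close> is zero and linearity suffices.\<close>
  have act1: "act (eps 1) x \<in> D U p" if "U \<in> \<U>" "x \<in> D U p" for U p x
    using weights that D0[OF that(1), of p] linear_imp_zero[OF lin[of 1]] N
    by (cases "p \<le> kk U") (auto simp: weight_decomposition_def)
  \<comment> \<open>For \<open>p > kk U\<close> the image is 0. At \<open>p = kk U + 1\<close> the
    target \<open>D U (kk U)\<close> may be nonzero, so \<open>DU0\<close> supplies its zero
    vector.\<close>
  have act2: "act (eps j) x \<in> (if p = 0 then {0} else D U (p - 1))"
    if "j \<in> {2..N}" "U \<in> \<U>" "x \<in> D U p" for j U p x
  proof (cases "p \<le> kk U")
    case True
    then show ?thesis using weights that unfolding weight_decomposition_def by blast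
  next
    case False
    then show ?thesis
      using that D0[OF that(2), of p] linear_imp_zero[OF lin[of j]] DU0[OF that(2)] by auto
  qed
  have "direct_sum scale {1..} ?Vg UNIV"
    using summands D D0 by (intro V.direct_sum_V_grade) auto
  then have "direct_sum pm_scale2 UNIV (g_grade N scale B ?Vg) (TVN N B)"
    by (intro V.direct_sum_g_grade N V.direct_sum_T_grade)
  moreover have "star N scale B act u v \<in> g_grade N scale B ?Vg (m + n)"
    if uv: "u \<in> g_grade N scale B ?Vg m" "v \<in> g_grade N scale B ?Vg n" for m n u v
  proof (rule V.star_in_g_grade[where Vg = ?Vg and act = act, OF N lin _ _ uv])
    show "act (eps 1) x \<in> ?Vg p" if "x \<in> ?Vg p" for p x
      by (rule V.V_grade_image[OF lin act1 that]) (use N in auto)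
    show "act (eps j) x \<in> ?Vg (p + 1)" if j: "j \<in> {2..N}" and "p \<ge> 1" "x \<in> ?Vg p" for j p x
      by (rule V.V_grade_image_lowering[OF lin act2[OF j] that(2,3)]) (use j in auto)
  qed
  ultimately show ?thesis
    unfolding Let_def a using V.bracket_in_g_grade[OF N] by blast
qed

end
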